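(* Let $p,q\geq2$ be integers with $\gcd(p,q)=1$. Let $F\colon(\mathbb{C}^3,0)\cong(\mathbb{R}^6,0)\to(\mathbb{C},0)\cong(\mathbb{R}^2,0)$ be the real polynomial function $$F(x,y,z)=\overline{xy}\,(x^p+y^q)+z^2,$$ and let $G\colon(\mathbb{C}^3,0)\to(\mathbb{C},0)$ be the complex polynomial function $$G(x,y,z)=xy\,(x^p+y^q)+z^2 .$$ Then the link $L_F$ is homeomorphic to the link $L_G$, but the corresponding Milnor fibrations are not equivalent; i.e. the corresponding open book decompositions of $\mathbb{S}^5$ are not equivalent.
   Context: For $H=F$ or $G$ (both with isolated singularity at the origin), the link is $L_H=H^{-1}(0)\cap\mathbb{S}^5_\varepsilon$ with $\mathbb{S}^5_\varepsilon$ a sufficiently small sphere centred at the origin. The map $H/|H|\colon\mathbb{S}^5_\varepsilon\setminus L_H\to\mathbb{S}^1$ is a $C^\infty$ locally trivial fibration, called the Milnor fibration of $H$. It defines an open-book decomposition of $\mathbb{S}^5$ with binding $L_H$ and with pages the fibres of $H/|H|$. Two such open-book decompositions (equivalently, Milnor fibrations) are equivalent if there is a homeomorphism of $\mathbb{S}^5$ carrying binding to binding and pages to pages. *)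

theory Defs
  imports "HOL-Analysis.Analysis"
begin

text \<open>
  We take \<open>complex \<times> complex \<times> complex\<close> for three-dimensional complex space. The library norm
  on products is the Euclidean one, so \<open>sphere 0 \<epsilon>\<close> is the round 5-sphere of radius \<open>\<epsilon>\<close>.
\<close>

type_synonym complex3 = "complex \<times> complex \<times> complex"

definition F :: "nat \<Rightarrow> nat \<Rightarrow> complex3 \<Rightarrow> complex" where
  "F p q = (\<lambda>(x, y, z). cnj (x * y) * (x ^ p + y ^ q) + z ^ 2)"

definition G :: "nat \<Rightarrow> nat \<Rightarrow> complex3 \<Rightarrow> complex" where
  "G p q = (\<lambda>(x, y, z). x * y * (x ^ p + y ^ q) + z ^ 2)"

definition link :: "(complex3 \<Rightarrow> complex) \<Rightarrow> real \<Rightarrow> complex3 set" where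
  "link H \<epsilon> = {v. H v = 0} \<inter> sphere 0 \<epsilon>"

definition milnor_map :: "(complex3 \<Rightarrow> complex) \<Rightarrow> complex3 \<Rightarrow> complex" where
  "milnor_map H v = H v / complex_of_real (cmod (H v))"

definition page :: "(complex3 \<Rightarrow> complex) \<Rightarrow> real \<Rightarrow> complex \<Rightarrow> complex3 set" where
  "page H \<epsilon> \<theta> = {v \<in> sphere 0 \<epsilon> - link H \<epsilon>. milnor_map H v = \<theta>}"

text \<open>
  An open book is represented by its binding together with the set of its (open) pages.
\<close>

type_synonym 'a open_book = "'a set \<times> 'a set set"

definition milnor_open_book :: "(complex3 \<Rightarrow> complex) \<Rightarrow> real \<Rightarrow> complex3 open_book" where
  "milnor_open_book H \<epsilon> = (link H \<epsilon>, page H \<epsilon> ` sphere 0 1)"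

text \<open>
  Equivalence of two open books on the same space \<open>S\<close>. The homeomorphism may permute the
  pages arbitrarily, and no compatibility with orientations is required.
\<close>

definition open_book_equiv ::
  "'a::topological_space set \<Rightarrow> 'a open_book \<Rightarrow> 'a open_book \<Rightarrow> bool" where
  "open_book_equiv S A B \<longleftrightarrow>
     (\<exists>h k. homeomorphism S S h k \<and> h ` fst A = fst B \<and> (\<lambda>P. h ` P) ` snd A = snd B)"

end

theory Submission
  imports Defs "HOL-Homology.Homology" "HOL-Real_Asymp.Real_Asymp"
begin

text \<open>
  On \<open>{F = 0}\<close> and \<open>{G = 0}\<close> the coordinate \<open>z\<close> vanishes wherever \<open>xy\<close> does, so multiplying \<open>z\<close> by
  \<open>xy / |xy|\<close> is a norm preserving homeomorphism between the links, for every radius.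

  The pages are told apart by the rank of their second homology. Write \<open>H = f(x, y) + z\<^sup>2\<close>. A weighted
  action identifies each page of \<open>H\<close> with \<open>{f + z\<^sup>2 = 1}\<close>, and the two open sets \<open>Re z > -1\<close> and \<open>Re z < 1\<close>
  exhibit this as a homotopy suspension of \<open>{f = 1}\<close>. Up to homotopy, \<open>{f = 1}\<close> is a connected \<open>K\<close>-fold
  cyclic cover of the plane minus two points, where \<open>K\<close> is the weight of \<open>f\<close> under the circle action.
  Hence the second homology of a page is free of rank \<open>K + 1\<close>, and \<open>K = pq + p + q\<close> for \<open>G\<close> whereas
  conjugation turns it into \<open>K = pq - p - q\<close> for \<open>F\<close>.
\<close>

section \<open>Homology of open covers\<close>

text \<open>The weights come from letting the action scale \<open>x\<close> with weight
  \<open>q\<close> and \<open>y\<close> with weight \<open>p\<close>: then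
  \<open>x ^ p + y ^ q\<close> has weight \<open>p * q\<close> and \<open>x * y\<close> has weight
  \<open>p + q\<close>. Conjugation keeps the radial weight of \<open>x * y\<close> but reverses its
  circle weight, so both functions share the radial weight \<open>p * q + p + q\<close> and only the
  circle weight tells them apart. Since \<open>F\<close> is not holomorphic, the argument is phrased
  for any continuous function with two such weights, and covers \<open>F\<close> and
  \<open>G\<close> alike. Coprimality enters twice: it makes the circle weight of \<open>F\<close>
  positive, and through Bezout it provides invertible monomial coordinates on the torus, where
  \<open>{f = 1}\<close> lies because \<open>f\<close> vanishes on both axes. The rank agrees with
  Euler characteristics: the twice punctured plane has characteristic \<open>-1\<close>, so a
  connected \<open>K\<close>-fold cover has \<open>-K\<close>, that is, first Betti number
  \<open>K + 1\<close>.\<close>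

lemma excision_open_cover:
  assumes "openin X A" "openin X B" "A \<union> B = topspace X"
  shows "relative_homology_group p X A \<cong> relative_homology_group p (subtopology X B) (A \<inter> B)"
proof -
  have AB: "A \<subseteq> topspace X" "B \<subseteq> topspace X"
    using assms openin_subset by auto
  have cl: "X closure_of (topspace X - B) \<subseteq> X interior_of A"
  proof -
    have "closedin X (topspace X - B)"
      using assms(2) by blast
    then have "X closure_of (topspace X - B) = topspace X - B"
      by (rule closure_of_closedin)
    moreover have "X interior_of A = A"
      using assms(1) by (rule interior_of_openin)
    ultimately show ?thesis
      using assms(3) by auto
  qed
  have "hom_induced p (subtopology X (topspace X - (topspace X - B))) (A - (topspace X - B))
          (subtopology X (topspace X)) A id
      \<in> iso (relative_homology_group p (subtopology X (topspace X - (topspace X - B))) (A - (topspace X - B)))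
            (relative_homology_group p (subtopology X (topspace X)) A)"
    by (rule homology_excision_axiom [OF cl AB(1)])
  moreover have "topspace X - (topspace X - B) = B" "A - (topspace X - B) = A \<inter> B"
    using AB by auto
  ultimately have "relative_homology_group p (subtopology X B) (A \<inter> B) \<cong> relative_homology_group p X A"
    by (simp add: is_isoI)
  then show ?thesis
    by (simp add: group.iso_sym)
qed

text \<open>Contractibility of \<open>A\<close> replaces absolute homology by homology relative to
  \<open>A\<close>, excision moves it into \<open>B\<close>, and contractibility of \<open>B\<close>
  makes the boundary map an isomorphism. Positivity of \<open>p\<close> identifies reduced and
  unreduced groups at both ends.\<close>

lemma homology_suspension_open_cover:
  assumes "openin X A" "openin X B" "A \<union> B = topspace X" "A \<inter> B \<noteq> {}"
    and "contractible_space (subtopology X A)" "contractible_space (subtopology X B)"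
    and "p > 0"
  shows "homology_group (p + 1) X \<cong> homology_group p (subtopology X (A \<inter> B))"
proof -
  have sub: "topspace X \<inter> A \<noteq> {}" "topspace (subtopology X B) \<inter> (A \<inter> B) \<noteq> {}"
    using assms(4) openin_subset [OF assms(1)] openin_subset [OF assms(2)] by auto
  have "homology_group (p + 1) X = reduced_homology_group (p + 1) X"
    using \<open>p > 0\<close> by (simp add: un_reduced_homology_group)
  also have "\<dots> \<cong> relative_homology_group (p + 1) X A"
    using assms sub by (simp add: isomorphic_reduced_homology_by_contractible)
  also have "\<dots> \<cong> relative_homology_group (p + 1) (subtopology X B) (A \<inter> B)"
    by (rule excision_open_cover [OF assms(1-3)])
  also have "\<dots> \<cong> reduced_homology_group p (subtopology (subtopology X B) (A \<inter> B))"
    using isomorphic_group_relative_homology_of_contractible [OF assms(6) sub(2), of "p + 1"] by simp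
  also have "\<dots> = homology_group p (subtopology X (A \<inter> B))"
    using \<open>p > 0\<close> by (simp add: un_reduced_homology_group subtopology_subtopology Int_absorb1 inf_commute)
  finally show ?thesis .
qed

text \<open>\<open>B\<close> is a union of handles attached to \<open>A\<close> along their two ends \<open>P\<close> and \<open>Q\<close>; each handle adds one loop.\<close>

lemma homology_attach_handles:
  assumes "openin X A" "openin X B" "A \<union> B = topspace X" "A \<noteq> {}"
    and "contractible_space (subtopology X A)"
    and "openin X P" "openin X Q" "disjnt P Q" "A \<inter> B = P \<union> Q"
    and f: "continuous_map (subtopology X B) (subtopology X P) f"
    and fP: "homotopic_with (\<lambda>h. True) (subtopology X P) (subtopology X P) f id"
    and fB: "homotopic_with (\<lambda>h. True) (subtopology X B) (subtopology X B) f id"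
  shows "homology_group 1 X \<cong> homology_group 0 (subtopology X Q)"
proof -
  let ?B = "subtopology X B" and ?PQ = "subtopology X (P \<union> Q)"
  have sub: "topspace X \<inter> A \<noteq> {}" "P \<subseteq> B" "Q \<subseteq> B" "P \<subseteq> topspace X" "Q \<subseteq> topspace X"
    using assms(4,9) openin_subset [OF assms(1)] openin_subset [OF assms(6)] openin_subset [OF assms(7)] by auto
  have PB: "subtopology ?B P = subtopology X P" and PQB: "subtopology ?B (P \<union> Q) = ?PQ"
    using sub by (auto simp: subtopology_subtopology Int_absorb1)
  \<comment> \<open>\<open>f\<close> pushes \<open>B\<close> into \<open>P\<close> and is homotopic
    to the identity on both, so the pair has no homology.\<close>
  have triv: "trivial_group (relative_homology_group k ?B P)" for k
    by (rule trivial_relative_homology_group_gen [where f = f]) (use f fP fB PB in auto)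
  \<comment> \<open>Exact sequence of the triple \<open>B\<close>, \<open>P \<union> Q\<close>,
    \<open>P\<close>: its outer terms vanish by \<open>triv\<close>.\<close>
  have conn: "hom_relboundary 1 ?B (P \<union> Q) P
      \<in> iso (relative_homology_group 1 ?B (P \<union> Q)) (relative_homology_group 0 ?PQ P)"
  proof (rule very_short_exact_sequence)
    show "exact_seq ([relative_homology_group 0 ?B P, relative_homology_group 0 ?PQ P,
        relative_homology_group 1 ?B (P \<union> Q), relative_homology_group 1 ?B P],
        [hom_induced 0 ?PQ P ?B P id, hom_relboundary 1 ?B (P \<union> Q) P, hom_induced 1 ?B P ?B (P \<union> Q) id])"
      using homology_exactness_triple_1 [of P "P \<union> Q" 1 ?B]
        homology_exactness_triple_2 [of P "P \<union> Q" 1 ?B] by (simp add: PQB)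
  qed (use triv in auto)
  have "homology_group 1 X = reduced_homology_group 1 X"
    by (simp add: un_reduced_homology_group)
  also have "\<dots> \<cong> relative_homology_group 1 X A"
    using assms sub by (simp add: isomorphic_reduced_homology_by_contractible)
  also have "\<dots> \<cong> relative_homology_group 1 ?B (A \<inter> B)"
    by (rule excision_open_cover [OF assms(1-3)])
  also have "\<dots> = relative_homology_group 1 ?B (P \<union> Q)"
    by (simp add: assms)
  also have "\<dots> \<cong> relative_homology_group 0 ?PQ P"
    using conn by (rule is_isoI)
  \<comment> \<open>Excision down to \<open>Q\<close> leaves \<open>Q\<close> relative to
    \<open>P \<inter> Q\<close>, which is empty.\<close>
  also have "\<dots> \<cong> relative_homology_group 0 (subtopology ?PQ Q) (P \<inter> Q)"
  proof (rule excision_open_cover)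
    show "openin ?PQ P" "openin ?PQ Q" "P \<union> Q = topspace ?PQ"
      using assms sub by (auto simp: openin_subtopology)
  qed
  also have "\<dots> = homology_group 0 (subtopology X Q)"
    using \<open>disjnt P Q\<close> by (simp add: disjnt_def subtopology_subtopology Int_absorb1)
  finally show ?thesis .
qed

lemma zeroth_homology_group_open_partition:
  assumes disj: "pairwise disjnt \<U>" and UU: "\<Union>\<U> = topspace X"
    and op: "\<And>V. V \<in> \<U> \<Longrightarrow> openin X V"
    and pc: "\<And>V. V \<in> \<U> \<Longrightarrow> V \<noteq> {} \<and> path_connectedin X V"
  shows "homology_group 0 X \<cong> free_Abelian_group \<U>"
proof -
  have "sum_group \<U> (\<lambda>S. homology_group 0 (subtopology X S)) \<cong> homology_group 0 X"
    using homology_additivity_axiom [OF disj UU op, of 0] by (rule is_isoI)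
  then have "homology_group 0 X \<cong> sum_group \<U> (\<lambda>S. homology_group 0 (subtopology X S))"
    by (simp add: group.iso_sym)
  also have "\<dots> \<cong> sum_group \<U> (\<lambda>i. integer_group)"
  proof (rule iso_sum_groupI)
    show "homology_group 0 (subtopology X V) \<cong> integer_group" if "V \<in> \<U>" for V
      using pc [OF that] op [OF that] openin_subset
      by (metis isomorphic_integer_zeroth_homology_group path_connectedin_def topspace_subtopology_subset)
  qed auto
  also have "\<dots> \<cong> free_Abelian_group \<U>"
    by (rule isomorphic_sum_integer_group)
  finally show ?thesis .
qed

section \<open>Cyclic covers of the twice punctured plane\<close>

lemma homeomorphic_by_inverse:
  assumes "continuous_on S f" "continuous_on T g"
    and "\<And>x. x \<in> S \<Longrightarrow> f x \<in> T \<and> g (f x) = x"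
    and "\<And>y. y \<in> T \<Longrightarrow> g y \<in> S \<and> f (g y) = y"
  shows "S homeomorphic T"
  using assms by (intro homeomorphicI [of f S T g]) (auto simp: image_iff; metis)+

lemma sgn_power_complex: "sgn (z ^ n) = sgn (z :: complex) ^ n"
  by (induction n) (auto simp: sgn_mult)

lemma sgn_eq_1_complex_iff: "sgn (z :: complex) = 1 \<longleftrightarrow> Im z = 0 \<and> Re z > 0"
proof
  assume "sgn z = 1"
  then have "z \<noteq> 0" by auto
  then have "z = of_real (cmod z)"
    using \<open>sgn z = 1\<close> by (simp add: sgn_eq divide_eq_eq)
  then show "Im z = 0 \<and> Re z > 0"
    by (metis Im_complex_of_real Re_complex_of_real \<open>z \<noteq> 0\<close> zero_less_norm_iff)
next
  assume "Im z = 0 \<and> Re z > 0"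
  then have "z = of_real (Re z)" "Re z > 0" by (auto simp: complex_eq_iff)
  then show "sgn z = 1"
    by (metis of_real_1 sgn_of_real sgn_pos)
qed

lemma sgn_exp_Im_0: "Im z = 0 \<Longrightarrow> sgn (exp z) = 1"
  by (simp add: sgn_eq_1_complex_iff Im_exp Re_exp)

lemma cnj_sgn_eq_inverse: "z \<noteq> 0 \<Longrightarrow> cnj (sgn z) = inverse (sgn z)"
  using complex_norm_square [of "sgn z"] by (simp add: norm_sgn inverse_eq_divide eq_divide_eq sgn_zero_iff mult.commute)

section \<open>Additivity of the logarithm on half planes\<close>

lemma quotient_right_half_plane:
  assumes "Re a > 0" "Re b > 0"
  shows "b / a \<notin> \<real>\<^sub>\<le>\<^sub>0"
proof
  assume "b / a \<in> \<real>\<^sub>\<le>\<^sub>0"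
  then obtain r where "b / a = of_real r" "r \<le> 0"
    by (auto simp: nonpos_Reals_def)
  moreover have "a \<noteq> 0"
    using assms by auto
  ultimately have "b = of_real r * a"
    by (simp add: divide_eq_eq)
  then have "Re b = r * Re a" by simp
  then show False
    using assms \<open>r \<le> 0\<close> by (auto simp: zero_less_mult_iff)
qed

lemma quotient_left_half_plane:
  assumes "Re a < 0" "Re b < 0"
  shows "b / a \<notin> \<real>\<^sub>\<le>\<^sub>0"
  using quotient_right_half_plane [of "-a" "-b"] assms by simp

text \<open>Arguments in the right half plane are below \<open>pi/2\<close> in absolute value, so
  their difference stays in the principal strip and no multiple of \<open>2 * pi\<close>
  appears.\<close>

lemma Ln_quotient_right_half_plane:
  assumes "Re a > 0" "Re b > 0"
  shows "Ln (b / a) = Ln b - Ln a"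
proof -
  have "a \<noteq> 0" "b \<noteq> 0" using assms by auto
  then have *: "exp (Ln b - Ln a) = b / a" by (simp add: exp_diff)
  have "\<bar>Im (Ln a)\<bar> < pi/2" "\<bar>Im (Ln b)\<bar> < pi/2"
    using assms Re_Ln_pos_lt \<open>a \<noteq> 0\<close> \<open>b \<noteq> 0\<close> by auto
  then have "-pi < Im (Ln b - Ln a)" "Im (Ln b - Ln a) \<le> pi"
    by auto
  then show ?thesis
    using Ln_exp * by metis
qed

text \<open>Negating all three numbers preserves the quotients and reduces the left half plane to
  the right one.\<close>

lemma Ln_quotient_chain:
  assumes "Re a > 0 \<and> Re b > 0 \<and> Re c > 0 \<or> Re a < 0 \<and> Re b < 0 \<and> Re c < 0"
  shows "Ln (c / a) = Ln (b / a) + Ln (c / b)"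
proof (cases "Re a > 0")
  case True
  then show ?thesis using assms by (simp add: Ln_quotient_right_half_plane)
next
  case False
  then show ?thesis
    using assms Ln_quotient_right_half_plane [of "-a" "-c"] Ln_quotient_right_half_plane [of "-a" "-b"]
      Ln_quotient_right_half_plane [of "-b" "-c"] by simp
qed

text \<open>The other finitely many values form a closed set, so a continuous map with finite range
  is locally constant. Sheet labels are such maps.\<close>

lemma openin_fibre_finite_range:
  fixes g :: "'a::topological_space \<Rightarrow> 'b::t1_space"
  assumes "continuous_on U g" "finite Z" "g ` U \<subseteq> Z"
  shows "openin (top_of_set U) {x \<in> U. g x = \<zeta>}"
proof -
  have "open (- (Z - {\<zeta>}))"
    using \<open>finite Z\<close> by (intro open_Compl finite_imp_closed finite_Diff)
  then have "openin (top_of_set U) (U \<inter> g -` (- (Z - {\<zeta>})))"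
    by (rule continuous_openin_preimage_gen [OF assms(1)])
  moreover have "U \<inter> g -` (- (Z - {\<zeta>})) = {x \<in> U. g x = \<zeta>}"
    using assms(3) by auto
  ultimately show ?thesis by simp
qed

section \<open>The cyclic cover, its parallel transport and its sheets\<close>

text \<open>The condition \<open>sgn z = 1\<close> says that \<open>z\<close> is a positive real number. Up to a factor
  \<open>\<real>\<^sub>>\<^sub>0\<close> in the first coordinate this is a \<open>K\<close>-fold cyclic cover of
  \<open>\<complex> - {0, 1}\<close> by the second coordinate.\<close>

definition cyclic_cover :: "nat \<Rightarrow> nat \<Rightarrow> (complex \<times> complex) set" where
  "cyclic_cover K c = {(s, v). v \<noteq> 0 \<and> sgn (s ^ K * v ^ c * (1 - v)) = 1}"

text \<open>Parallel transport of \<open>s\<close> when the base coordinate moves from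
  \<open>v\<close> to \<open>w\<close>: a branch of the \<open>K\<close>-th root of
  \<open>v ^ c * (1 - v) / (w ^ c * (1 - w))\<close>, which keeps
  \<open>s ^ K * v ^ c * (1 - v)\<close> constant. Taking logarithms of quotients serves the left
  half plane too and gives the value 1 at \<open>w = v\<close>.\<close>

definition lift_factor :: "nat \<Rightarrow> nat \<Rightarrow> complex \<Rightarrow> complex \<Rightarrow> complex" where
  "lift_factor K c v w = exp (- (of_nat c / of_nat K) * Ln (w / v) - (1 / of_nat K) * Ln ((1 - w) / (1 - v)))"

lemma lift_factor_nonzero [simp]: "lift_factor K c v w \<noteq> 0"
  by (simp add: lift_factor_def)

text \<open>Both points lie in \<open>Re < 0\<close> or both in \<open>0 < Re < 1\<close>. Then
  \<open>v\<close> and \<open>w\<close> share a half plane, as do \<open>1 - v\<close> and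
  \<open>1 - w\<close>, so the quotients in \<open>lift_factor\<close> avoid the branch cut.\<close>

definition same_side :: "complex \<Rightarrow> complex \<Rightarrow> bool" where
  "same_side v w \<longleftrightarrow> Re v < 1 \<and> Re w < 1 \<and> (Re v > 0 \<and> Re w > 0 \<or> Re v < 0 \<and> Re w < 0)"

lemma same_side_nonzero:
  assumes "same_side v w"
  shows "v \<noteq> 0" "w \<noteq> 0" "1 - v \<noteq> 0" "1 - w \<noteq> 0" "v \<noteq> 1" "w \<noteq> 1"
  using assms by (auto simp: same_side_def)

lemma lift_factor_power:
  assumes "K > 0" "same_side v w"
  shows "lift_factor K c v w ^ K * w ^ c * (1 - w) = v ^ c * (1 - v)"
proof -
  note nz = same_side_nonzero [OF assms(2)]
  have "lift_factor K c v w ^ K = exp (of_nat K * (- (of_nat c / of_nat K) * Ln (w / v) - (1 / of_nat K) * Ln ((1 - w) / (1 - v))))"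
    by (simp only: lift_factor_def exp_of_nat_mult)
  also have "of_nat K * (- (of_nat c / of_nat K) * Ln (w / v) - (1 / of_nat K) * Ln ((1 - w) / (1 - v)))
     = - (of_nat c * Ln (w / v)) - Ln ((1 - w) / (1 - v))"
    using \<open>K > 0\<close> by (simp add: field_simps)
  also have "exp \<dots> = inverse ((w / v) ^ c) * inverse ((1 - w) / (1 - v))"
    using nz by (simp add: exp_diff exp_minus exp_of_nat_mult divide_inverse)
  finally show ?thesis
    using nz by (simp add: field_simps)
qed

lemma lift_factor_chain:
  assumes "same_side u v" "same_side v w"
  shows "lift_factor K c u v * lift_factor K c v w = lift_factor K c u w"
proof -
  have "Ln (w / u) = Ln (v / u) + Ln (w / v)"
    by (rule Ln_quotient_chain) (use assms in \<open>auto simp: same_side_def\<close>)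
  moreover have "Ln ((1 - w) / (1 - u)) = Ln ((1 - v) / (1 - u)) + Ln ((1 - w) / (1 - v))"
    by (rule Ln_quotient_chain) (use assms in \<open>auto simp: same_side_def\<close>)
  ultimately show ?thesis
    by (simp add: lift_factor_def add_divide_distrib algebra_simps flip: exp_add)
qed

lemma lift_factor_self: "v \<noteq> 0 \<Longrightarrow> v \<noteq> 1 \<Longrightarrow> lift_factor K c v v = 1"
  by (simp add: lift_factor_def)

lemma same_side_sym: "same_side v w \<Longrightarrow> same_side w v"
  by (auto simp: same_side_def)

lemma continuous_on_lift_factor [continuous_intros]:
  assumes "continuous_on S v" "continuous_on S w" "\<And>x. x \<in> S \<Longrightarrow> same_side (v x) (w x)"
  shows "continuous_on S (\<lambda>x. lift_factor K c (v x) (w x))"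
proof -
  have "w x / v x \<notin> \<real>\<^sub>\<le>\<^sub>0" "(1 - w x) / (1 - v x) \<notin> \<real>\<^sub>\<le>\<^sub>0" "v x \<noteq> 0" "v x \<noteq> 1" if "x \<in> S" for x
    using assms(3) [OF that] quotient_right_half_plane [of "v x" "w x"]
      quotient_left_half_plane [of "v x" "w x"] quotient_right_half_plane [of "1 - v x" "1 - w x"]
    by (auto simp: same_side_def)
  then show ?thesis
    unfolding lift_factor_def
    by (intro continuous_intros assms) auto
qed

lemma cyclic_cover_lift:
  assumes "K > 0" "(s, v) \<in> cyclic_cover K c" "same_side v w"
  shows "(s * lift_factor K c v w, w) \<in> cyclic_cover K c"
proof -
  have "(s * lift_factor K c v w) ^ K * w ^ c * (1 - w) = s ^ K * (v ^ c * (1 - v))"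
    using lift_factor_power [OF assms(1,3), of c] by (simp add: power_mult_distrib mult.assoc)
  then show ?thesis
    using assms same_side_nonzero [OF assms(3)] by (auto simp: cyclic_cover_def mult.assoc)
qed

text \<open>The direction of the first coordinate after transport to the base point of the strip containing \<open>v\<close>:
  it takes finitely many values and labels the sheets over that strip.\<close>

definition base :: "complex \<Rightarrow> complex" where
  "base v = (if Re v < 0 then -1 else 1/2)"

definition sheet :: "nat \<Rightarrow> nat \<Rightarrow> complex \<times> complex \<Rightarrow> complex" where
  "sheet K c = (\<lambda>(s, v). sgn (s * lift_factor K c v (base v)))"

lemma same_side_base: "Re v < 0 \<or> 0 < Re v \<and> Re v < 1 \<Longrightarrow> same_side v (base v)"
  by (auto simp: same_side_def base_def)

text \<open>By the cocycle rule \<open>lift_factor_chain\<close>, transport to \<open>w\<close>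
  followed by transport to the base point equals direct transport to the base point.\<close>

lemma sheet_lift:
  assumes "same_side v w"
  shows "sheet K c (s * lift_factor K c v w, w) = sheet K c (s, v)"
proof -
  have "base w = base v"
    using assms by (auto simp: base_def same_side_def)
  moreover have "same_side w (base w)"
    using assms by (auto simp: base_def same_side_def)
  ultimately show ?thesis
    using lift_factor_chain [OF assms, of "base v"] by (simp add: sheet_def mult.assoc)
qed

text \<open>At the base point \<open>-1\<close> the factor \<open>v ^ c * (1 - v)\<close> has
  direction \<open>(-1) ^ c\<close>, at \<open>1/2\<close> it is positive. The defining condition of
  the cover, transported there, then determines the \<open>K\<close>-th power of the label.\<close>

lemma sheet_range:
  assumes "K > 0" "(s, v) \<in> cyclic_cover K c"
  shows "Re v < 0 \<Longrightarrow> sheet K c (s, v) ^ K = (-1) ^ c"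
    and "0 < Re v \<Longrightarrow> Re v < 1 \<Longrightarrow> sheet K c (s, v) ^ K = 1"
proof -
  let ?b = "base v"
  have main: "sgn (s * lift_factor K c v ?b) ^ K * sgn ?b ^ c * sgn (1 - ?b) = 1"
    if "Re v < 0 \<or> 0 < Re v \<and> Re v < 1"
    using cyclic_cover_lift [OF assms same_side_base [OF that]]
    by (simp add: cyclic_cover_def sgn_mult sgn_power_complex)
  have s2: "sgn (2::complex) = 1" "sgn (1 / 2 :: complex) = 1" "1 - 1 / 2 = (1 / 2 :: complex)"
    by (subst sgn_eq_1_complex_iff, simp)+ simp
  show "sheet K c (s, v) ^ K = (-1) ^ c" if "Re v < 0"
  proof -
    have "sgn (s * lift_factor K c v (-1)) ^ K * (-1) ^ c = 1"
      using main that s2 by (auto simp: base_def sgn_minus)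
    then have "sgn (s * lift_factor K c v (-1)) ^ K * ((-1) ^ c * (-1) ^ c) = (-1) ^ c"
      by (metis mult.assoc mult_1)
    then show ?thesis
      using that by (simp add: sheet_def base_def flip: power_mult_distrib)
  qed
  show "sheet K c (s, v) ^ K = 1" if "0 < Re v" "Re v < 1"
    using main that s2 by (auto simp: sheet_def base_def)
qed

lemma continuous_on_sheet:
  assumes "K > 0"
  shows "continuous_on {x \<in> cyclic_cover K c. Re (snd x) < 0} (sheet K c)"
    and "continuous_on {x \<in> cyclic_cover K c. 0 < Re (snd x) \<and> Re (snd x) < 1} (sheet K c)"
proof -
  have nz: "fst x \<noteq> 0" if "x \<in> cyclic_cover K c" for x
    using that \<open>K > 0\<close> by (auto simp: cyclic_cover_def zero_power)
  have "continuous_on {x \<in> cyclic_cover K c. Re (snd x) < 0}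
     (\<lambda>x. sgn (fst x * lift_factor K c (snd x) (-1)))"
    by (intro continuous_intros) (auto simp: same_side_def nz)
  then show "continuous_on {x \<in> cyclic_cover K c. Re (snd x) < 0} (sheet K c)"
    by (rule continuous_on_eq) (auto simp: sheet_def base_def)
  have "continuous_on {x \<in> cyclic_cover K c. 0 < Re (snd x) \<and> Re (snd x) < 1}
     (\<lambda>x. sgn (fst x * lift_factor K c (snd x) (1/2)))"
    by (intro continuous_intros) (auto simp: same_side_def nz)
  then show "continuous_on {x \<in> cyclic_cover K c. 0 < Re (snd x) \<and> Re (snd x) < 1} (sheet K c)"
    by (rule continuous_on_eq) (auto simp: sheet_def base_def)
qed

section \<open>The cut cover is contractible\<close>

text \<open>Cutting the cover along the \<open>K\<close> arcs over the negative real axis and along the single arc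
  \<open>s > 0\<close> over \<open>(0, 1)\<close> leaves a disc; these \<open>K + 1\<close> arcs account for the rank of the first homology.\<close>

definition cut_cover :: "nat \<Rightarrow> nat \<Rightarrow> (complex \<times> complex) set" where
  "cut_cover K c = {(s, v) \<in> cyclic_cover K c. v \<notin> \<real>\<^sub>\<le>\<^sub>0 \<and> \<not> (v \<in> \<real> \<and> Re v \<le> 1 \<and> s \<in> \<real>\<^sub>\<ge>\<^sub>0)}"

text \<open>The coordinates \<open>\<sigma> = s v\<^bsup>c/K\<^esup>\<close> and \<open>t = |1 - v|\<close> on the cut cover.\<close>

definition cut_chart :: "nat \<Rightarrow> (complex \<times> real) set" where
  "cut_chart K = {(\<sigma>, t). \<sigma> \<notin> \<real>\<^sub>\<ge>\<^sub>0 \<and> t > 0 \<and> 1 - of_real t * cnj (sgn \<sigma>) ^ K \<notin> \<real>\<^sub>\<le>\<^sub>0}"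

text \<open>In terms of \<open>\<sigma>\<close> the defining condition reads
  \<open>sgn \<sigma> ^ K * sgn (1 - v) = 1\<close>, so \<open>\<sigma>\<close> determines the
  direction of \<open>1 - v\<close> and only the modulus \<open>t\<close> remains free. If
  \<open>\<sigma>\<close> is positive then \<open>v\<close> is real and below 1, so the ray missing
  from the chart is exactly the arc \<open>s > 0\<close> over \<open>(0, 1)\<close>.\<close>

lemma homeomorphic_cut_cover:
  assumes "K > 0"
  shows "cut_cover K c homeomorphic cut_chart K"
proof -
  \<comment> \<open>Principal branch of the power of \<open>v\<close> with exponent
    \<open>c / K\<close>, continuous off the nonpositive reals and positive on positive
    reals.\<close>
  define \<rho> where "\<rho> v = exp ((of_nat c / of_nat K) * Ln v)" for v
  have \<rho>0 [simp]: "\<rho> v \<noteq> 0" for v by (simp add: \<rho>_def)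
  have \<rho>K: "\<rho> v ^ K = v ^ c" if "v \<noteq> 0" for v
  proof -
    have "\<rho> v ^ K = exp (of_nat K * ((of_nat c / of_nat K) * Ln v))"
      by (simp only: \<rho>_def exp_of_nat_mult)
    also have "\<dots> = exp (of_nat c * Ln v)"
      using \<open>K > 0\<close> by simp
    also have "\<dots> = v ^ c"
      using that by (simp add: exp_of_nat_mult)
    finally show ?thesis .
  qed
  have \<rho>pos: "\<exists>r>0. \<rho> v = of_real r" if "v \<in> \<real>" "Re v > 0" for v
  proof -
    have "v = of_real (Re v)" using that by (metis of_real_Re)
    then have "Ln v = of_real (ln (Re v))"
      using that by (metis Ln_of_real)
    then have "\<rho> v = of_real (exp ((c / K) * ln (Re v)))"
      by (simp add: \<rho>_def exp_of_real [symmetric] del: exp_of_real)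
    then show ?thesis using exp_gt_zero by blast
  qed
  have nnR: "z \<notin> \<real>\<^sub>\<ge>\<^sub>0 \<Longrightarrow> z \<noteq> 0" "z \<notin> \<real>\<^sub>\<le>\<^sub>0 \<Longrightarrow> z \<noteq> 0" for z :: complex by auto
  have unit: "sgn \<sigma> ^ K * cnj (sgn \<sigma>) ^ K = 1" if "\<sigma> \<noteq> 0" for \<sigma>
    using that by (simp add: cnj_sgn_eq_inverse sgn_zero_iff flip: power_mult_distrib)
  have nn: "of_real r * s \<in> \<real>\<^sub>\<ge>\<^sub>0 \<longleftrightarrow> s \<in> \<real>\<^sub>\<ge>\<^sub>0" if "r > 0" for r and s :: complex
    using that by (auto simp: complex_nonneg_Reals_iff zero_le_mult_iff)
  let ?f = "\<lambda>(s, v). (s * \<rho> v, cmod (1 - v))"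
  let ?V = "\<lambda>(\<sigma>, t). 1 - of_real t * cnj (sgn \<sigma>) ^ K"
  let ?g = "\<lambda>x. (fst x / \<rho> (?V x), ?V x)"
  show ?thesis
  proof (rule homeomorphic_by_inverse)
    show "continuous_on (cut_cover K c) ?f"
      unfolding \<rho>_def case_prod_unfold
      by (intro continuous_intros) (auto simp: cut_cover_def)
    show "continuous_on (cut_chart K) ?g"
      unfolding \<rho>_def case_prod_unfold
      by (intro continuous_intros) (auto simp: cut_chart_def)
    have f: "?f x \<in> cut_chart K \<and> ?g (?f x) = x" if x: "x \<in> cut_cover K c" for x
    proof -
      obtain s v where sv: "x = (s, v)" by force
      then have v: "v \<notin> \<real>\<^sub>\<le>\<^sub>0" and s: "\<not> (v \<in> \<real> \<and> Re v \<le> 1 \<and> s \<in> \<real>\<^sub>\<ge>\<^sub>0)"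
        and eq: "sgn (s ^ K * v ^ c * (1 - v)) = 1"
        using x by (auto simp: cut_cover_def cyclic_cover_def)
      define \<sigma> where "\<sigma> = s * \<rho> v"
      have "v \<noteq> 0" using v by auto
      have "s \<noteq> 0" "v \<noteq> 1" using eq \<open>K > 0\<close> by (auto simp: zero_power)
      then have "\<sigma> \<noteq> 0" by (simp add: \<sigma>_def)
      have eq1: "sgn \<sigma> ^ K * sgn (1 - v) = 1"
        using eq \<rho>K [OF \<open>v \<noteq> 0\<close>] by (simp add: \<sigma>_def sgn_mult sgn_power_complex power_mult_distrib flip: sgn_power_complex)
      then have "sgn (1 - v) = cnj (sgn \<sigma>) ^ K"
        using unit [OF \<open>\<sigma> \<noteq> 0\<close>] by (metis mult.commute mult.left_commute mult_1_right)
      then have V: "1 - of_real (cmod (1 - v)) * cnj (sgn \<sigma>) ^ K = v"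
        using \<open>v \<noteq> 1\<close> by (simp only: flip: \<open>sgn (1 - v) = cnj (sgn \<sigma>) ^ K\<close>) (simp add: sgn_eq)
      have "\<sigma> \<notin> \<real>\<^sub>\<ge>\<^sub>0"
      proof
        assume "\<sigma> \<in> \<real>\<^sub>\<ge>\<^sub>0"
        then have "sgn \<sigma> = 1"
          using \<open>\<sigma> \<noteq> 0\<close> by (auto simp: sgn_eq_1_complex_iff complex_nonneg_Reals_iff complex_eq_iff cmod_eq_Re)
        then have "sgn (1 - v) = 1" using eq1 by simp
        then have "v \<in> \<real>" "Re v < 1"
          by (auto simp: sgn_eq_1_complex_iff complex_is_Real_iff)
        moreover have "Re v > 0"
          using v \<open>v \<in> \<real>\<close> by (auto simp: complex_nonpos_Reals_iff complex_is_Real_iff)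
        ultimately obtain r where "r > 0" "\<rho> v = of_real r" using \<rho>pos by blast
        then have "s \<in> \<real>\<^sub>\<ge>\<^sub>0"
          using \<open>\<sigma> \<in> \<real>\<^sub>\<ge>\<^sub>0\<close> nn [of r s] by (simp add: \<sigma>_def mult.commute)
        then show False
          using s \<open>v \<in> \<real>\<close> \<open>Re v < 1\<close> by auto
      qed
      then show ?thesis
        using V v \<open>v \<noteq> 1\<close> by (simp add: sv cut_chart_def flip: \<sigma>_def) (simp add: \<sigma>_def)
    qed
    have g: "?g x \<in> cut_cover K c \<and> ?f (?g x) = x" if x: "x \<in> cut_chart K" for x
    proof -
      obtain \<sigma> t where st: "x = (\<sigma>, t)" by force
      define v where "v = 1 - of_real t * cnj (sgn \<sigma>) ^ K"
      have \<sigma>: "\<sigma> \<notin> \<real>\<^sub>\<ge>\<^sub>0" and t: "t > 0" and v: "v \<notin> \<real>\<^sub>\<le>\<^sub>0"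
        using x by (auto simp: st cut_chart_def v_def)
      have "\<sigma> \<noteq> 0" "v \<noteq> 0" using \<sigma> v by auto
      have "(\<sigma> / \<rho> v) ^ K * v ^ c * (1 - v) = \<sigma> ^ K * (of_real t * cnj (sgn \<sigma>) ^ K)"
        using \<open>v \<noteq> 0\<close> by (simp add: power_divide \<rho>K) (simp add: v_def)
      also have "sgn \<dots> = 1"
      proof -
        have "sgn (cnj (sgn \<sigma>)) = cnj (sgn \<sigma>)"
          using \<open>\<sigma> \<noteq> 0\<close> by (subst sgn_eq) (simp add: norm_sgn)
        then show ?thesis
          using t unit [OF \<open>\<sigma> \<noteq> 0\<close>] by (simp only: sgn_mult sgn_power_complex sgn_of_real) simp
      qed
      finally have T: "(\<sigma> / \<rho> v, v) \<in> cyclic_cover K c"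
        using \<open>v \<noteq> 0\<close> by (simp add: cyclic_cover_def)
      have "\<not> (v \<in> \<real> \<and> Re v \<le> 1 \<and> \<sigma> / \<rho> v \<in> \<real>\<^sub>\<ge>\<^sub>0)"
      proof
        assume *: "v \<in> \<real> \<and> Re v \<le> 1 \<and> \<sigma> / \<rho> v \<in> \<real>\<^sub>\<ge>\<^sub>0"
        then have "Re v > 0"
          using v by (auto simp: complex_nonpos_Reals_iff complex_is_Real_iff)
        then obtain r where "r > 0" "\<rho> v = of_real r" using \<rho>pos * by blast
        then show False
          using nn [of r "\<sigma> / \<rho> v"] * \<sigma> by simp
      qed
      moreover have "cmod (1 - v) = t"
        using t \<open>\<sigma> \<noteq> 0\<close> by (simp add: v_def norm_mult norm_power norm_sgn)
      ultimately show ?thesis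
        using T v by (simp add: st cut_cover_def flip: v_def)
    qed
    show "?f x \<in> cut_chart K \<and> ?g (?f x) = x" if "x \<in> cut_cover K c" for x
      using f [OF that] .
    show "?g x \<in> cut_cover K c \<and> ?f (?g x) = x" if "x \<in> cut_chart K" for x
      using g [OF that] .
  qed
qed

text \<open>The last condition of the chart fails only when the unit
  \<open>cnj (sgn \<sigma>) ^ K\<close> is 1 and \<open>t \<ge> 1\<close>. Moving \<open>t\<close>
  linearly to \<open>1/2\<close> never enters this set, at \<open>t = 1/2\<close> the condition is
  automatic, and the slit plane is star shaped about \<open>-1\<close>.\<close>

lemma contractible_cut_chart: "contractible (cut_chart K)"
proof -
  let ?S = "cut_chart K"
  let ?E = "\<lambda>\<sigma> t. 1 - of_real t * cnj (sgn \<sigma>) ^ K :: complex"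
  have retract: "1 - of_real t' * cnj (sgn \<sigma>) ^ K \<notin> \<real>\<^sub>\<le>\<^sub>0"
    if "(\<sigma>, t) \<in> ?S" "0 < t'" "t' < 1 \<or> t' \<le> t" for \<sigma> t t'
  proof
    assume neg: "?E \<sigma> t' \<in> \<real>\<^sub>\<le>\<^sub>0"
    have st: "\<sigma> \<noteq> 0" "t > 0" "?E \<sigma> t \<notin> \<real>\<^sub>\<le>\<^sub>0"
      using that by (auto simp: cut_chart_def)
    have unit: "cmod (cnj (sgn \<sigma>) ^ K) = 1"
      using st by (simp add: norm_power norm_sgn)
    define \<omega> where "\<omega> = cnj (sgn \<sigma>) ^ K"
    have *: "Im \<omega> = 0" "t' * Re \<omega> \<ge> 1"
      using neg that by (auto simp: complex_nonpos_Reals_iff simp flip: \<omega>_def)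
    then have "Re \<omega> > 0"
      using that(2) by (metis less_le_trans zero_less_mult_pos zero_less_one)
    then have "Re \<omega> = 1"
      using unit * by (simp add: cmod_eq_Re flip: \<omega>_def)
    then have "t' \<ge> 1" using * by simp
    then have "t \<ge> 1" using that by auto
    then show False
      using st(3) \<open>Re \<omega> = 1\<close> \<open>Im \<omega> = 0\<close> by (simp add: complex_nonpos_Reals_iff flip: \<omega>_def)
  qed
  have 1: "homotopic_with_canon (\<lambda>x. True) ?S ?S id (\<lambda>(\<sigma>, t). (\<sigma>, 1/2))"
    unfolding homotopic_with_def
  proof (intro exI conjI ballI allI)
    let ?h = "\<lambda>(u::real, x). (fst x, (1 - u) * snd x + u * (1/2)) :: complex \<times> real"
    have *: "0 < (1 - u) * t + u * (1/2)" "(1 - u) * t + u * (1/2) < 1 \<or> (1 - u) * t + u * (1/2) \<le> t"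
      if "0 \<le> u" "u \<le> 1" "0 < t" for u t :: real
    proof -
      show "0 < (1 - u) * t + u * (1/2)"
        using that by (cases "u = 0") (auto intro: add_nonneg_pos)
      show "(1 - u) * t + u * (1/2) < 1 \<or> (1 - u) * t + u * (1/2) \<le> t"
      proof (cases "t \<ge> 1/2")
        case True
        then have "u * (1/2) \<le> u * t" using that by (intro mult_left_mono) auto
        then show ?thesis by (simp add: algebra_simps)
      next
        case False
        then have "(1 - u) * t \<le> (1 - u) * (1/2)" using that by (intro mult_left_mono) auto
        then show ?thesis by (simp add: algebra_simps)
      qed
    qed
    show "continuous_map (prod_topology (top_of_set {0..1}) (top_of_set ?S)) (top_of_set ?S) ?h"
      unfolding prod_topology_subtopology_eu continuous_map_subtopology_eu
    proof
      show "continuous_on ({0..1} \<times> ?S) ?h"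
        unfolding case_prod_unfold by (intro continuous_intros)
      show "?h \<in> ({0..1} \<times> ?S) \<rightarrow> ?S"
      proof clarify
        fix u :: real and \<sigma> t assume u: "u \<in> {0..1}" and st: "(\<sigma>, t) \<in> ?S"
        then have "t > 0" "\<sigma> \<notin> \<real>\<^sub>\<ge>\<^sub>0" by (auto simp: cut_chart_def)
        then show "(fst (\<sigma>, t), (1 - u) * snd (\<sigma>, t) + u * (1/2)) \<in> ?S"
          using u * [of u t] retract [OF st, of "(1 - u) * t + u * (1/2)"] by (simp add: cut_chart_def del: of_real_add of_real_diff of_real_mult)
      qed
    qed
  qed auto
  have 2: "homotopic_with_canon (\<lambda>x. True) ?S ?S (\<lambda>(\<sigma>, t). (\<sigma>, 1/2)) (\<lambda>x. (-1, 1/2))"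
    unfolding homotopic_with_def
  proof (intro exI conjI ballI allI)
    let ?h = "\<lambda>(u::real, x). (of_real (1 - u) * fst x - of_real u, 1/2) :: complex \<times> real"
    show "continuous_map (prod_topology (top_of_set {0..1}) (top_of_set ?S)) (top_of_set ?S) ?h"
      unfolding prod_topology_subtopology_eu continuous_map_subtopology_eu
    proof
      show "continuous_on ({0..1} \<times> ?S) ?h"
        unfolding case_prod_unfold by (intro continuous_intros)
      show "?h \<in> ({0..1} \<times> ?S) \<rightarrow> ?S"
      proof clarify
        fix u :: real and \<sigma> t assume u: "u \<in> {0..1}" and st: "(\<sigma>, t) \<in> ?S"
        define \<sigma>' where "\<sigma>' = of_real (1 - u) * \<sigma> - of_real u"
        have "\<sigma> \<notin> \<real>\<^sub>\<ge>\<^sub>0" using st by (auto simp: cut_chart_def)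
        have \<sigma>': "\<sigma>' \<notin> \<real>\<^sub>\<ge>\<^sub>0"
        proof
          assume "\<sigma>' \<in> \<real>\<^sub>\<ge>\<^sub>0"
          then have *: "(1 - u) * Im \<sigma> = 0" "(1 - u) * Re \<sigma> \<ge> u"
            by (auto simp: \<sigma>'_def complex_nonneg_Reals_iff)
          moreover from this u have "u < 1"
            by (cases "u = 1") auto
          ultimately have "Im \<sigma> = 0" "(1 - u) * Re \<sigma> \<ge> 0"
            using u by auto
          then have "Re \<sigma> \<ge> 0" using \<open>u < 1\<close> by (simp add: zero_le_mult_iff)
          then show False
            using \<open>\<sigma> \<notin> \<real>\<^sub>\<ge>\<^sub>0\<close> \<open>Im \<sigma> = 0\<close> by (simp add: complex_nonneg_Reals_iff)
        qed
        have "1 - of_real (1/2) * cnj (sgn \<sigma>') ^ K \<notin> \<real>\<^sub>\<le>\<^sub>0"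
        proof
          assume "1 - of_real (1/2) * cnj (sgn \<sigma>') ^ K \<in> \<real>\<^sub>\<le>\<^sub>0"
          then have "Re (cnj (sgn \<sigma>') ^ K) \<ge> 2"
            by (simp add: complex_nonpos_Reals_iff)
          moreover have "cmod (cnj (sgn \<sigma>') ^ K) \<le> 1"
            by (simp add: norm_power norm_sgn power_le_one)
          ultimately show False
            using complex_Re_le_cmod [of "cnj (sgn \<sigma>') ^ K"] by linarith
        qed
        then show "(of_real (1 - u) * fst (\<sigma>, t) - of_real u, 1/2) \<in> ?S"
          using \<sigma>' unfolding \<sigma>'_def by (simp add: cut_chart_def)
      qed
    qed
  qed auto
  show ?thesis
    unfolding contractible_def using homotopic_with_trans [OF 1 2] by blast
qed

section \<open>Handles along the removed arcs\<close>

text \<open>Open neighbourhoods of the removed arcs: every sheet over \<open>Re v < 0\<close>, but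
  over the strip \<open>0 < Re v < 1\<close> only the sheet with label 1, because only one of the
  arcs over \<open>(0, 1)\<close> is cut.\<close>

definition bands :: "nat \<Rightarrow> nat \<Rightarrow> (complex \<times> complex) set" where
  "bands K c = {x \<in> cyclic_cover K c. Re (snd x) < 0 \<or> 0 < Re (snd x) \<and> Re (snd x) < 1 \<and> sheet K c x = 1}"

lemma cyclic_cover_sheet:
  assumes "K > 0" "sgn \<zeta> = \<zeta>" "\<zeta> ^ K * v ^ c * (1 - v) = of_real r" "r > 0" "same_side v w" "v = base w" "t > 0"
  shows "(of_real t * \<zeta> * lift_factor K c v w, w) \<in> cyclic_cover K c"
    and "sheet K c (of_real t * \<zeta> * lift_factor K c v w, w) = \<zeta>"
proof -
  have "(of_real t * \<zeta>) ^ K * v ^ c * (1 - v) = of_real t ^ K * of_real r"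
    using assms(3) by (simp add: power_mult_distrib mult.assoc)
  also have "sgn \<dots> = 1"
    using assms by (simp add: sgn_mult sgn_power_complex sgn_of_real)
  finally have "(of_real t * \<zeta>, v) \<in> cyclic_cover K c"
    using same_side_nonzero [OF assms(5)] by (simp add: cyclic_cover_def)
  from cyclic_cover_lift [OF \<open>K > 0\<close> this assms(5)]
  show "(of_real t * \<zeta> * lift_factor K c v w, w) \<in> cyclic_cover K c" .
  have "base v = v"
    using assms(6) by (auto simp: base_def)
  then have "sheet K c (of_real t * \<zeta>, v) = \<zeta>"
    using assms same_side_nonzero [OF assms(5)] by (simp add: sheet_def lift_factor_self sgn_mult sgn_of_real)
  then show "sheet K c (of_real t * \<zeta> * lift_factor K c v w, w) = \<zeta>"
    using sheet_lift [OF assms(5)] by simp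
qed

lemma sheet_reconstruct:
  assumes "K > 0" "(s, w) \<in> cyclic_cover K c" "Re w < 0 \<or> 0 < Re w \<and> Re w < 1"
  shows "\<exists>t>0. s = of_real t * sheet K c (s, w) * lift_factor K c (base w) w"
proof -
  let ?l = "s * lift_factor K c w (base w)"
  have "s \<noteq> 0" using assms by (auto simp: cyclic_cover_def zero_power)
  have ss: "same_side w (base w)" "same_side (base w) w"
    using same_side_base [OF assms(3)] same_side_sym by auto
  have "of_real (cmod ?l) * sheet K c (s, w) = ?l"
    using \<open>s \<noteq> 0\<close> by (simp add: sheet_def sgn_eq)
  moreover have "lift_factor K c w (base w) * lift_factor K c (base w) w = 1"
    using lift_factor_chain [OF ss] same_side_nonzero [OF ss(1)] by (simp add: lift_factor_self)
  ultimately have "s = of_real (cmod ?l) * sheet K c (s, w) * lift_factor K c (base w) w"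
    by (metis mult.assoc mult_1_right)
  then show ?thesis
    using \<open>s \<noteq> 0\<close> by (intro exI [of _ "cmod ?l"]) simp
qed

text \<open>The piece is the image of the convex set \<open>{0<..} \<times> U\<close>: the ray
  through \<open>\<zeta>\<close> over the base point \<open>b\<close>, transported to each
  \<open>w\<close> in \<open>U\<close>.\<close>

lemma path_connected_sheet_piece:
  assumes "K > 0" "sgn \<zeta> = \<zeta>" "\<zeta> ^ K * b ^ c * (1 - b) = of_real r" "r > 0"
    and "convex U" "\<And>w. w \<in> U \<Longrightarrow> base w = b \<and> (Re w < 0 \<or> 0 < Re w \<and> Re w < 1)" "U \<noteq> {}"
  shows "path_connected {x \<in> cyclic_cover K c. snd x \<in> U \<and> sheet K c x = \<zeta>}" (is "path_connected ?P")
    and "{x \<in> cyclic_cover K c. snd x \<in> U \<and> sheet K c x = \<zeta>} \<noteq> {}"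
proof -
  define g where "g t w = (of_real t * \<zeta> * lift_factor K c b w, w)" for t w
  let ?f = "\<lambda>x. g (fst x) (snd x)"
  have ss: "same_side b w" if "w \<in> U" for w
    using same_side_base [of w] same_side_sym assms(6) that by auto
  have "?f ` ({0<..} \<times> U) = ?P"
  proof (intro equalityI subsetI)
    fix x assume "x \<in> ?f ` ({0<..} \<times> U)"
    then obtain t w where "x = g t w" "t > 0" "w \<in> U"
      by auto
    then show "x \<in> ?P"
      unfolding g_def using cyclic_cover_sheet [OF assms(1-4) ss] assms(6) by simp
  next
    fix x assume x: "x \<in> ?P"
    then obtain s w where sw: "x = (s, w)" "w \<in> U" "(s, w) \<in> cyclic_cover K c" "sheet K c (s, w) = \<zeta>"
      by (cases x) auto
    then obtain t where "t > 0" "s = of_real t * \<zeta> * lift_factor K c b w"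
      using sheet_reconstruct [OF assms(1), of s w c] assms(6) by metis
    then show "x \<in> ?f ` ({0<..} \<times> U)"
      using sw by (intro image_eqI [of _ _ "(t, w)"]) (auto simp: g_def)
  qed
  moreover have "path_connected ({0::real<..} \<times> U)"
    by (intro convex_imp_path_connected convex_Times assms(5) convex_real_interval)
  moreover have "continuous_on ({0::real<..} \<times> U) ?f"
    unfolding g_def using ss by (intro continuous_intros) auto
  ultimately show "path_connected ?P"
    using path_connected_continuous_image by metis
  have "{0::real<..} \<times> U \<noteq> {}"
    using assms(7) by (auto intro: exI [of _ 1])
  with \<open>?f ` ({0<..} \<times> U) = ?P\<close> show "?P \<noteq> {}" by blast
qed

text \<open>Over \<open>(0, 1)\<close> both logarithms in the lift factor are real, so transport to
  \<open>1/2\<close> is multiplication by a positive number. Label 1 there means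
  \<open>s > 0\<close>, which is the cut.\<close>

lemma sheet_real:
  assumes "v \<in> \<real>" "0 < Re v" "Re v < 1"
  shows "sheet K c (s, v) = sgn s"
proof -
  obtain r where r: "v = of_real r" "0 < r" "r < 1"
    using assms by (auto elim!: Reals_cases)
  have "Ln ((1 / 2) / v) = of_real (ln ((1 / 2) / r))"
    using r Ln_of_real [of "(1/2) / r"] by simp
  moreover have "Ln ((1 - 1 / 2) / (1 - v)) = of_real (ln ((1 / 2) / (1 - r)))"
    using r Ln_of_real [of "(1/2) / (1 - r)"] by simp
  ultimately have "lift_factor K c v (1 / 2) =
      exp (of_real (- (c / K) * ln ((1 / 2) / r) - (1 / K) * ln ((1 / 2) / (1 - r))))"
    by (simp add: lift_factor_def)
  then have "sgn (lift_factor K c v (1 / 2)) = 1"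
    by (metis sgn_exp_Im_0 Im_complex_of_real)
  then show ?thesis
    using assms by (simp add: sheet_def base_def sgn_mult)
qed

lemma openin_fibre_sheet:
  assumes "K > 0"
  shows "openin (top_of_set (cyclic_cover K c)) {x \<in> cyclic_cover K c. Re (snd x) < 0 \<and> sheet K c x = \<zeta>}"
    and "openin (top_of_set (cyclic_cover K c)) {x \<in> cyclic_cover K c. 0 < Re (snd x) \<and> Re (snd x) < 1 \<and> sheet K c x = \<zeta>}"
proof -
  let ?T = "cyclic_cover K c"
  let ?L = "{x \<in> ?T. Re (snd x) < 0}" and ?R = "{x \<in> ?T. 0 < Re (snd x) \<and> Re (snd x) < 1}"
  have fin: "finite {z::complex. z ^ K = 1}" "finite {z::complex. z ^ K = (-1) ^ c}"
    using assms by (auto intro!: finite_nth_roots)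
  have "?L = ?T \<inter> {x. Re (snd x) < 0}" "?R = ?T \<inter> {x. 0 < Re (snd x) \<and> Re (snd x) < 1}"
    by auto
  moreover have "openin (top_of_set ?T) (?T \<inter> {x. Re (snd x) < 0})"
    "openin (top_of_set ?T) (?T \<inter> {x. 0 < Re (snd x) \<and> Re (snd x) < 1})"
    by (intro openin_open_Int open_Collect_less open_Collect_conj continuous_intros)+
  ultimately have L: "openin (top_of_set ?T) ?L" and R: "openin (top_of_set ?T) ?R"
    by simp_all
  have "openin (top_of_set ?L) {x \<in> ?L. sheet K c x = \<zeta>}"
    by (rule openin_fibre_finite_range [OF continuous_on_sheet(1) [OF assms] fin(2)])
      (use sheet_range(1) [OF assms] in auto)
  from openin_trans [OF this L]
  show "openin (top_of_set ?T) {x \<in> ?T. Re (snd x) < 0 \<and> sheet K c x = \<zeta>}"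
    by (simp add: conj_assoc)
  have "openin (top_of_set ?R) {x \<in> ?R. sheet K c x = \<zeta>}"
    by (rule openin_fibre_finite_range [OF continuous_on_sheet(2) [OF assms] fin(1)])
      (use sheet_range(2) [OF assms] in auto)
  from openin_trans [OF this R]
  show "openin (top_of_set ?T) {x \<in> ?T. 0 < Re (snd x) \<and> Re (snd x) < 1 \<and> sheet K c x = \<zeta>}"
    by (simp add: conj_assoc)
qed

lemma openin_half_space:
  fixes f :: "'a::topological_space \<Rightarrow> real"
  assumes "openin (top_of_set T) S" "continuous_on UNIV f"
  shows "openin (top_of_set T) {x \<in> S. f x > 0}"
proof -
  have "open {x. f x > 0}"
    by (rule open_Collect_less) (use assms in auto)
  then have "openin (top_of_set T) (S \<inter> {x. f x > 0})"
    using assms(1) by (metis openin_Int_open)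
  moreover have "S \<inter> {x. f x > 0} = {x \<in> S. f x > 0}" by auto
  ultimately show ?thesis by simp
qed

lemma openin_bands:
  assumes "K > 0"
  shows "openin (top_of_set (cyclic_cover K c)) (bands K c)"
proof -
  have "bands K c = {x \<in> cyclic_cover K c. - Re (snd x) > 0} \<union>
    {x \<in> cyclic_cover K c. 0 < Re (snd x) \<and> Re (snd x) < 1 \<and> sheet K c x = 1}"
    by (auto simp: bands_def)
  moreover have "openin (top_of_set (cyclic_cover K c)) {x \<in> cyclic_cover K c. - Re (snd x) > 0}"
    by (intro openin_half_space continuous_intros) auto
  ultimately show ?thesis
    using openin_fibre_sheet(2) [OF assms, of c 1] by (simp add: openin_Un)
qed

lemma openin_cut_cover: "openin (top_of_set (cyclic_cover K c)) (cut_cover K c)"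
proof -
  have eq: "cut_cover K c = cyclic_cover K c \<inter> - (UNIV \<times> \<real>\<^sub>\<le>\<^sub>0) \<inter> - (\<real>\<^sub>\<ge>\<^sub>0 \<times> (\<real> \<inter> {v. Re v \<le> 1}))"
    by (auto simp: cut_cover_def)
  have "closed {v. Re v \<le> 1}"
    by (simp add: closed_halfspace_Re_le)
  then have "open (- (UNIV \<times> \<real>\<^sub>\<le>\<^sub>0) \<inter> - (\<real>\<^sub>\<ge>\<^sub>0 \<times> (\<real> \<inter> {v. Re v \<le> 1})) :: (complex \<times> complex) set)"
    by (intro open_Int open_Compl closed_Times closed_UNIV closed_Int closed_complex_Reals closed_nonpos_Reals_complex closed_nonneg_Reals_complex)
  then show ?thesis
    unfolding eq Int_assoc by (rule openin_open_Int)
qed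

text \<open>Slide \<open>v\<close> vertically towards the line \<open>Im v = -1\<close>; the first coordinate follows by lifting.\<close>

definition lower :: "nat \<Rightarrow> nat \<Rightarrow> real \<Rightarrow> complex \<times> complex \<Rightarrow> complex \<times> complex" where
  "lower K c u = (\<lambda>(s, v). let w = Complex (Re v) (u * Im v - (1 - u)) in (s * lift_factor K c v w, w))"

lemma lower_bands:
  assumes "K > 0" "x \<in> bands K c"
  shows "lower K c u x \<in> bands K c" "snd (lower K c u x) = Complex (Re (snd x)) (u * Im (snd x) - (1 - u))"
    "lower K c 1 x = x"
proof -
  obtain s v where x: "x = (s, v)" by force
  then have v: "Re v < 0 \<or> 0 < Re v \<and> Re v < 1" and T: "(s, v) \<in> cyclic_cover K c"
    using assms by (auto simp: bands_def)
  let ?w = "Complex (Re v) (u * Im v - (1 - u))"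
  have "same_side v ?w"
    using v by (auto simp: same_side_def)
  then show "lower K c u x \<in> bands K c"
    using assms cyclic_cover_lift [OF assms(1) T, of ?w] sheet_lift [of v ?w K c s]
    by (auto simp: x lower_def bands_def Let_def)
  have "v \<noteq> 0" "v \<noteq> 1" using v by auto
  then show "lower K c 1 x = x"
    by (simp add: x lower_def lift_factor_self)
qed (auto simp: lower_def case_prod_unfold Let_def)

lemma homotopic_lower:
  assumes "K > 0" "S \<subseteq> bands K c" "\<And>u x. 0 \<le> u \<Longrightarrow> u \<le> 1 \<Longrightarrow> x \<in> S \<Longrightarrow> lower K c u x \<in> S"
  shows "homotopic_with (\<lambda>h. True) (top_of_set S) (top_of_set S) (lower K c 0) id"
proof -
  have "continuous_on ({0..1} \<times> S) (\<lambda>y. lower K c (fst y) (snd y))"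
  proof -
    have "Complex a b = of_real a + \<i> * of_real b" for a b
      by (simp add: complex_eq_iff)
    then have eq: "lower K c (fst y) (snd y) =
        (fst (snd y) * lift_factor K c (snd (snd y)) (of_real (Re (snd (snd y))) + \<i> * of_real (fst y * Im (snd (snd y)) - (1 - fst y))),
         of_real (Re (snd (snd y))) + \<i> * of_real (fst y * Im (snd (snd y)) - (1 - fst y)))" for y
      by (simp add: lower_def case_prod_unfold Let_def)
    show ?thesis
      unfolding eq using assms(2) by (intro continuous_intros) (auto simp: same_side_def bands_def)
  qed
  then have "continuous_map (prod_topology (top_of_set {0..1}) (top_of_set S)) (top_of_set S) (\<lambda>y. lower K c (fst y) (snd y))"
    unfolding prod_topology_subtopology_eu continuous_map_subtopology_eu using assms(3) by auto
  moreover have "lower K c 1 x = x" if "x \<in> S" for x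
    using lower_bands(3) assms that by blast
  ultimately show ?thesis
    by (subst homotopic_with) (auto intro!: exI [of _ "\<lambda>y. lower K c (fst y) (snd y)"])
qed

text \<open>Sliding down retracts the bands onto their lower halves up to homotopy, so
  \<open>homology_attach_handles\<close> applies with the contractible cut cover as
  \<open>A\<close>, and the upper halves count the loops.\<close>

lemma first_homology_cyclic_cover_bands:
  assumes "K > 0"
  shows "homology_group 1 (top_of_set (cyclic_cover K c))
    \<cong> homology_group 0 (top_of_set {x \<in> bands K c. Im (snd x) > 0})"
proof -
  let ?T = "cyclic_cover K c" and ?B = "bands K c" and ?A = "cut_cover K c"
  let ?P = "{x \<in> ?B. - Im (snd x) > 0}" and ?Q = "{x \<in> ?B. Im (snd x) > 0}"
  have sub: "?B \<subseteq> ?T" "?A \<subseteq> ?T" by (auto simp: bands_def cut_cover_def)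
  have T: "v \<noteq> 0 \<and> v \<noteq> 1 \<and> s \<noteq> 0" if "(s, v) \<in> ?T" for s v
    using that assms by (auto simp: cyclic_cover_def zero_power)
  have subt: "subtopology (top_of_set ?T) S = top_of_set S" if "S \<subseteq> ?T" for S
    using that by (simp add: subtopology_subtopology Int_absorb1)
  have sgn1: "s \<in> \<real>\<^sub>\<ge>\<^sub>0 \<longleftrightarrow> sgn s = 1" if "s \<noteq> 0" for s :: complex
    using that by (auto simp: sgn_eq_1_complex_iff complex_nonneg_Reals_iff complex_eq_iff cmod_eq_Re)
  have real: "v \<in> \<real> \<Longrightarrow> v \<in> \<real>\<^sub>\<le>\<^sub>0 \<longleftrightarrow> Re v \<le> 0" "v \<in> \<real>\<^sub>\<le>\<^sub>0 \<Longrightarrow> v \<in> \<real>" for v :: complex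
    by (auto simp: complex_nonpos_Reals_iff complex_is_Real_iff)
  \<comment> \<open>The removed arcs are precisely the real points of the bands.\<close>
  have mem_A: "(s, v) \<in> ?A \<longleftrightarrow> v \<notin> \<real> \<or> (s, v) \<notin> ?B" if "(s, v) \<in> ?T" for s v
  proof (cases "v \<in> \<real>")
    case True
    then have "Re v \<noteq> 0" "Re v \<noteq> 1"
      using T [OF that] by (auto simp: complex_is_Real_iff complex_eq_iff)
    then show ?thesis
      using that True real [of v] T [OF that] sgn1 [of s] sheet_real [OF True, of K c s]
      by (auto simp: cut_cover_def bands_def)
  next
    case False
    then show ?thesis
      using that real by (auto simp: cut_cover_def)
  qed
  have "homology_group 1 (top_of_set ?T) \<cong> homology_group 0 (subtopology (top_of_set ?T) ?Q)"
  proof (rule homology_attach_handles)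
    show "openin (top_of_set ?T) ?A"
      by (rule openin_cut_cover)
    show "openin (top_of_set ?T) ?B"
      by (rule openin_bands [OF assms])
    then show "openin (top_of_set ?T) ?P" "openin (top_of_set ?T) ?Q"
      by (intro openin_half_space continuous_intros; assumption)+
    show "?A \<union> ?B = topspace (top_of_set ?T)"
      using mem_A sub by auto
    show "disjnt ?P ?Q"
      by (auto simp: disjnt_def)
    show "?A \<inter> ?B = ?P \<union> ?Q"
    proof -
      have "(s, v) \<in> ?A \<longleftrightarrow> Im v \<noteq> 0" if "(s, v) \<in> ?B" for s v
        using mem_A [of s v] that sub by (auto simp: complex_is_Real_iff)
      then show ?thesis by force
    qed
    have "(-1, 1/2) \<in> cut_chart K"
      using complex_Re_le_cmod [of "(-1) ^ K"]
      by (auto simp: cut_chart_def sgn_minus complex_nonpos_Reals_iff norm_power)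
    then show "?A \<noteq> {}"
      using homeomorphic_cut_cover [OF assms, of c] by (metis empty_iff homeomorphic_empty(2))
    have "contractible ?A"
      using homeomorphic_cut_cover [OF assms, of c] contractible_cut_chart homeomorphic_contractible_eq by blast
    then show "contractible_space (subtopology (top_of_set ?T) ?A)"
      using subt sub by simp
    have hB: "homotopic_with (\<lambda>h. True) (top_of_set ?B) (top_of_set ?B) (lower K c 0) id"
      by (rule homotopic_lower) (auto simp: assms lower_bands)
    \<comment> \<open>Sliding turns a negative imaginary part \<open>a\<close> into
      \<open>u * a - (1 - u)\<close>, which is still negative, so the lower half is
      preserved.\<close>
    have neg: "u * a < 1 - u" if "0 \<le> u" "u \<le> 1" "a < 0" for u a :: real
      using that by (cases "u = 0") (auto intro: less_le_trans [of _ 0] simp: mult_pos_neg)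
    have hP: "homotopic_with (\<lambda>h. True) (top_of_set ?P) (top_of_set ?P) (lower K c 0) id"
      by (rule homotopic_lower) (auto simp: assms lower_bands neg)
    show "homotopic_with (\<lambda>h. True) (subtopology (top_of_set ?T) ?P) (subtopology (top_of_set ?T) ?P) (lower K c 0) id"
      using hP subt [of ?P] sub by force
    show "homotopic_with (\<lambda>h. True) (subtopology (top_of_set ?T) ?B) (subtopology (top_of_set ?T) ?B) (lower K c 0) id"
      using hB subt [of ?B] sub by force
    have "continuous_on ?B (lower K c 0)"
      using homotopic_with_imp_continuous_maps [OF hB] by auto
    then have "continuous_map (top_of_set ?B) (top_of_set ?P) (lower K c 0)"
      by (auto simp: lower_bands assms)
    then show "continuous_map (subtopology (top_of_set ?T) ?B) (subtopology (top_of_set ?T) ?P) (lower K c 0)"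
      using subt [of ?B] subt [of ?P] sub by force
  qed
  then show ?thesis
    using subt [of ?Q] sub by force
qed

text \<open>The upper halves of the bands split into \<open>K\<close> pieces over the quadrant
  \<open>Re < 0\<close>, \<open>Im > 0\<close>, labelled by the \<open>K\<close>-th roots of
  \<open>(-1) ^ c\<close>, and one piece over the strip.\<close>

theorem first_homology_cyclic_cover:
  assumes "K > 0"
  shows "\<exists>\<U> :: (complex \<times> complex) set set. finite \<U> \<and> card \<U> = K + 1 \<and>
    homology_group 1 (top_of_set (cyclic_cover K c)) \<cong> free_Abelian_group \<U>"
proof -
  let ?T = "cyclic_cover K c"
  let ?Q = "{x \<in> bands K c. Im (snd x) > 0}"
  let ?Z = "{z::complex. z ^ K = (-1) ^ c}"
  let ?L = "{v. Re v < 0 \<and> Im v > 0}" and ?R = "{v. 0 < Re v \<and> Re v < 1 \<and> Im v > 0}"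
  let ?V = "\<lambda>\<zeta>. {x \<in> ?T. snd x \<in> ?L \<and> sheet K c x = \<zeta>}"
  let ?W = "{x \<in> ?T. snd x \<in> ?R \<and> sheet K c x = 1}"
  define \<U> where "\<U> = insert ?W (?V ` ?Z)"
  have cvx: "convex ?L" "convex ?R"
    by (auto intro!: convex_Int convex_halfspace_Re_lt convex_halfspace_Re_gt convex_halfspace_Im_gt simp: Collect_conj_eq)
  have "Complex (-1) 1 \<in> ?L" "Complex (1/2) 1 \<in> ?R" by auto
  then have ne: "?L \<noteq> {}" "?R \<noteq> {}" by blast+
  have V: "path_connected (?V \<zeta>) \<and> ?V \<zeta> \<noteq> {}" if "\<zeta> \<in> ?Z" for \<zeta>
  proof -
    have "cmod (\<zeta> ^ K) = cmod ((-1) ^ c)"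
      using that by simp
    then have "cmod \<zeta> ^ K = 1 ^ K"
      by (simp add: norm_power)
    then have "cmod \<zeta> = 1"
      by (rule power_eq_imp_eq_base) (use assms in auto)
    then have "sgn \<zeta> = \<zeta>" by (simp add: sgn_eq)
    \<comment> \<open>The condition of the cover at the base point \<open>-1\<close>; the 2 is
      \<open>1 - (-1)\<close>.\<close>
    moreover have "\<zeta> ^ K * (-1) ^ c * (1 - (-1)) = of_real 2"
      using that by (simp flip: power_mult_distrib)
    ultimately show ?thesis
      using path_connected_sheet_piece [OF assms, of \<zeta> "-1" c 2 ?L] cvx ne by (auto simp: base_def)
  qed
  have W: "path_connected ?W \<and> ?W \<noteq> {}"
    using path_connected_sheet_piece [OF assms, of 1 "1/2" c "(1/2) ^ c * (1/2)" ?R] cvx ne by (auto simp: base_def)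
  have sub: "?Q \<subseteq> ?T" "\<Union>\<U> \<subseteq> ?Q"
    by (auto simp: bands_def \<U>_def)
  have "?Q \<subseteq> \<Union>\<U>"
  proof
    fix x assume x: "x \<in> ?Q"
    show "x \<in> \<Union>\<U>"
    proof (cases "Re (snd x) < 0")
      case True
      then have "sheet K c x \<in> ?Z" "x \<in> ?V (sheet K c x)"
        using x sheet_range(1) [OF assms, of "fst x" "snd x" c] by (auto simp: bands_def)
      then show ?thesis unfolding \<U>_def by blast
    qed (use x in \<open>auto simp: bands_def \<U>_def\<close>)
  qed
  with sub have UQ: "\<Union>\<U> = ?Q" by auto
  have op: "openin (top_of_set ?Q) U" if "U \<in> \<U>" for U
  proof -
    have "openin (top_of_set ?T) U"
    proof -
      have "continuous_on UNIV (\<lambda>x :: complex \<times> complex. Im (snd x))"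
        by (intro continuous_intros)
      note op = openin_half_space [OF openin_fibre_sheet(1) [OF assms] this]
        openin_half_space [OF openin_fibre_sheet(2) [OF assms] this]
      have "?V \<zeta> = {x \<in> {x \<in> ?T. Re (snd x) < 0 \<and> sheet K c x = \<zeta>}. Im (snd x) > 0}" for \<zeta>
        by auto
      then have "openin (top_of_set ?T) (?V \<zeta>)" for \<zeta>
        by (simp only: op)
      moreover have "?W = {x \<in> {x \<in> ?T. 0 < Re (snd x) \<and> Re (snd x) < 1 \<and> sheet K c x = 1}. Im (snd x) > 0}"
        by auto
      then have "openin (top_of_set ?T) ?W"
        by (simp only: op)
      ultimately show ?thesis
        using that unfolding \<U>_def by blast
    qed
    then show ?thesis
      using sub that by (meson Union_upper openin_subset_trans subset_trans)
  qed
  have disj: "pairwise disjnt \<U>"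
    by (auto simp: \<U>_def pairwise_def disjnt_def)
  have "homology_group 0 (top_of_set ?Q) \<cong> free_Abelian_group \<U>"
  proof (rule zeroth_homology_group_open_partition [OF disj])
    show "\<Union>\<U> = topspace (top_of_set ?Q)" using UQ by simp
    show "U \<noteq> {} \<and> path_connectedin (top_of_set ?Q) U" if "U \<in> \<U>" for U
    proof -
      have "path_connected U \<and> U \<noteq> {}"
        using that V W unfolding \<U>_def by blast
      moreover have "U \<subseteq> ?Q"
        using that UQ by blast
      ultimately show ?thesis
        by (simp add: path_connectedin_subtopology)
    qed
  qed (use op in auto)
  then have iso: "homology_group 1 (top_of_set ?T) \<cong> free_Abelian_group \<U>"
    using first_homology_cyclic_cover_bands [OF assms] iso_trans by blast
  have fin: "finite ?Z" "card ?Z = K"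
    using assms by (auto intro!: finite_nth_roots card_nth_roots)
  have "inj_on ?V ?Z"
  proof (rule inj_onI)
    fix \<zeta> \<eta> assume "\<zeta> \<in> ?Z" "\<eta> \<in> ?Z" "?V \<zeta> = ?V \<eta>"
    then show "\<zeta> = \<eta>" using V [of \<zeta>] by blast
  qed
  moreover have "?W \<notin> ?V ` ?Z"
    using W by fastforce
  ultimately have "card \<U> = K + 1"
    using fin by (simp add: \<U>_def card_image)
  moreover have "finite \<U>"
    using fin by (simp add: \<U>_def)
  ultimately show ?thesis
    using iso by blast
qed

section \<open>Suspensions of polar weighted functions\<close>

text \<open>Radial and polar weights: \<open>exp l\<close> acts through \<open>\<real>\<^sub>>\<^sub>0\<close> with degree \<open>N\<close>
  and through the circle with degree \<open>K\<close>. For a holomorphic polynomial \<open>K = N\<close>.\<close>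

definition twist :: "nat \<Rightarrow> nat \<Rightarrow> complex \<Rightarrow> complex" where
  "twist N K l = Complex (Re l / N) (Im l / K)"

lemma twist_add: "twist N K (l + m) = twist N K l + twist N K m"
  by (simp add: twist_def complex_eq_iff add_divide_distrib)

lemma twist_0 [simp]: "twist N K 0 = 0"
  by (simp add: twist_def complex_eq_iff)

lemma continuous_on_twist [continuous_intros]:
  assumes "continuous_on S g"
  shows "continuous_on S (\<lambda>x. twist N K (g x))"
proof -
  have "twist N K z = of_real (Re z * inverse N) + \<i> * of_real (Im z * inverse K)" for z
    by (simp add: twist_def complex_eq_iff divide_inverse del: of_real_mult of_real_inverse)
  then show ?thesis
    using assms by (auto intro!: continuous_intros)
qed

lemma twist_of_real: "twist N K (of_real t) = of_real (t / N)"
  by (simp add: twist_def complex_eq_iff)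

text \<open>The action is parametrised by a logarithm \<open>l\<close>, because dividing the
  imaginary part by \<open>K\<close> makes sense for \<open>l\<close> but in general not for
  \<open>exp l\<close>. It is normalised so that \<open>f\<close> is multiplied by
  \<open>exp l\<close> whatever the weights.\<close>

locale polar_weighted =
  fixes f :: "complex \<times> complex \<Rightarrow> complex" and p q N K :: nat
  assumes pos: "p > 0" "q > 0" "N > 0" "K > 0"
    and cont: "continuous_on UNIV f"
    and weighted: "f (exp (of_nat q * twist N K l) * x, exp (of_nat p * twist N K l) * y) = exp l * f (x, y)"
    and nontrivial: "\<exists>v. f v \<noteq> 0"
begin

definition act :: "complex \<Rightarrow> complex \<times> complex \<Rightarrow> complex \<times> complex" where
  "act l v = (exp (of_nat q * twist N K l) * fst v, exp (of_nat p * twist N K l) * snd v)"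

lemma f_act [simp]: "f (act l v) = exp l * f v"
  using weighted by (simp add: act_def)

lemma act_0 [simp]: "act 0 v = v"
  by (simp add: act_def)

lemma continuous_on_act [continuous_intros]:
  "continuous_on S l \<Longrightarrow> continuous_on S v \<Longrightarrow> continuous_on S (\<lambda>x. act (l x) (v x))"
  unfolding act_def by (intro continuous_intros)

lemma continuous_on_f [continuous_intros]:
  "continuous_on S v \<Longrightarrow> continuous_on S (\<lambda>x. f (v x))"
  using continuous_on_compose2 [OF cont] by auto

lemma f_0: "f (0, 0) = 0"
proof -
  have "f (0, 0) = exp 1 * f (0, 0)"
    using f_act [of 1 "(0, 0)"] by (simp add: act_def)
  moreover have "exp (1::complex) \<noteq> 1"
    using exp_eq_1 [of 1] by auto
  ultimately show ?thesis by simp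
qed

section \<open>The affine fibre as a homotopy suspension\<close>

definition fibre :: "(complex \<times> complex) set" where
  "fibre = {v. f v = 1}"

lemma fibre_nonempty: "fibre \<noteq> {}"
proof -
  obtain v where "f v \<noteq> 0" using nontrivial by blast
  then have "f (act (- Ln (f v)) v) = 1"
    by (simp add: exp_minus)
  then show ?thesis
    unfolding fibre_def by blast
qed

definition susp :: "complex3 set" where
  "susp = {u. f (fst u, fst (snd u)) + (snd (snd u)) ^ 2 = 1}"

definition cap :: "complex \<Rightarrow> complex3 set" where
  "cap \<sigma> = {u \<in> susp. Re (\<sigma> * snd (snd u)) > -1}"

text \<open>Powers of \<open>t\<close> in place of \<open>exp (ln t)\<close> let the flow be
  continued to \<open>t = 0\<close>, where it collapses \<open>x\<close> and \<open>y\<close> to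
  0.\<close>

lemma act_powr:
  assumes "t > 0"
  shows "act (of_real (ln t) + l) v =
     (of_real (t powr (q / N)) * (exp (of_nat q * twist N K l) * fst v),
      of_real (t powr (p / N)) * (exp (of_nat p * twist N K l) * snd v))"
proof -
  have *: "exp (of_nat n * of_real (ln t / N) :: complex) = of_real (t powr (n / N))" for n :: nat
  proof -
    have "of_nat n * of_real (ln t / N) = (of_real (n / N * ln t) :: complex)" by simp
    then have "exp (of_nat n * of_real (ln t / N)) = (of_real (exp (n / N * ln t)) :: complex)"
      by (simp only: exp_of_real)
    then show ?thesis using assms by (simp add: powr_def)
  qed
  show ?thesis
    by (simp add: act_def twist_add twist_of_real exp_add distrib_left * mult.assoc del: of_real_divide)
qed

text \<open>Put \<open>w = 1 - \<sigma> * z\<close>, so that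
  \<open>f = 1 - z ^ 2 = w * (2 - w)\<close>. Shrinking \<open>w\<close> to \<open>t * w\<close>
  requires multiplying \<open>f\<close> by \<open>t * (2 - t * w) / (2 - w)\<close>, which the
  action achieves. On the cap \<open>Re w < 2\<close>, so numerator and denominator stay in the
  right half plane and the logarithm is continuous. At \<open>t = 0\<close> the point
  \<open>(0, 0, \<sigma>)\<close> is reached.\<close>

lemma contractible_cap:
  assumes "\<sigma> ^ 2 = 1"
  shows "contractible (cap \<sigma>)"
proof -
  let ?w = "\<lambda>u::complex3. 1 - \<sigma> * snd (snd u)"
  let ?l = "\<lambda>(t::real) u. Ln ((2 - of_real t * ?w u) / (2 - ?w u))"
  let ?h = "\<lambda>y. (of_real (fst y powr (q / N)) * (exp (of_nat q * twist N K (?l (fst y) (snd y))) * fst (snd y)),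
      of_real (fst y powr (p / N)) * (exp (of_nat p * twist N K (?l (fst y) (snd y))) * fst (snd (snd y))),
      \<sigma> * (1 - of_real (fst y) * ?w (snd y)))"
  have half: "Re (2 - of_real t * ?w u) > 0" "Re (2 - ?w u) > 0" if "u \<in> cap \<sigma>" "0 \<le> t" "t \<le> 1" for t u
  proof -
    have less: "Re (?w u) < 2"
      using that by (simp add: cap_def)
    then show "Re (2 - ?w u) > 0" by simp
    have "t * r < 2" if "r < 2" for r
    proof (cases "r \<le> 0")
      case True
      then have "t * r \<le> 0"
        using \<open>0 \<le> t\<close> by (simp add: mult_nonneg_nonpos)
      then show ?thesis by simp
    next
      case False
      then have "t * r \<le> r"
        using \<open>0 \<le> t\<close> \<open>t \<le> 1\<close> by (simp add: mult_left_le_one_le)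
      then show ?thesis using that by simp
    qed
    then have "t * Re (?w u) < 2"
      using less by blast
    then show "Re (2 - of_real t * ?w u) > 0" by simp
  qed
  have notneg: "(2 - of_real t * ?w u) / (2 - ?w u) \<notin> \<real>\<^sub>\<le>\<^sub>0" "2 - ?w u \<noteq> 0" if "u \<in> cap \<sigma>" "0 \<le> t" "t \<le> 1" for t u
    using quotient_right_half_plane half [OF that] by (blast, force)
  have into: "?h (t, u) \<in> cap \<sigma>" if u: "u \<in> cap \<sigma>" and t: "0 \<le> t" "t \<le> 1" for t u
  proof -
    obtain x y z where xyz: "u = (x, y, z)" by (cases u) auto
    define w where "w = 1 - \<sigma> * z"
    define L where "L = Ln ((2 - of_real t * w) / (2 - w))"
    have "\<sigma> * (\<sigma> * a) = a" for a
      using assms by (simp add: power2_eq_square flip: mult.assoc)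
    then have z: "z = \<sigma> * (1 - w)" "\<sigma> * (\<sigma> * (1 - of_real t * w)) = 1 - of_real t * w"
      by (auto simp: w_def)
    have f: "f (x, y) = w * (2 - w)"
    proof -
      have "z ^ 2 = (1 - w) ^ 2"
        using assms z(1) by (simp add: power_mult_distrib)
      moreover have "f (x, y) = 1 - z ^ 2"
        using u by (simp add: xyz cap_def susp_def eq_diff_eq)
      ultimately have "f (x, y) = 1 - (1 - w) ^ 2"
        by simp
      then show ?thesis
        by (simp add: algebra_simps power2_eq_square)
    qed
    have "f (of_real (t powr (q / N)) * (exp (of_nat q * twist N K L) * x),
             of_real (t powr (p / N)) * (exp (of_nat p * twist N K L) * y))
        = of_real t * w * (2 - of_real t * w)"
    proof (cases "t = 0")
      case True
      then show ?thesis using f_0 by simp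
    next
      case False
      then have "t > 0" using t by simp
      have nz: "2 - w \<noteq> 0" "2 - of_real t * w \<noteq> 0"
        using half [OF u t] unfolding xyz w_def by force+
      have "f (act (of_real (ln t) + L) (x, y)) = exp (of_real (ln t)) * exp L * f (x, y)"
        by (simp add: exp_add)
      also have "\<dots> = of_real t * ((2 - of_real t * w) / (2 - w)) * (w * (2 - w))"
        using nz \<open>t > 0\<close> by (simp add: f L_def exp_of_real)
      also have "\<dots> = of_real t * w * (2 - of_real t * w)"
        using nz by simp
      finally show ?thesis
        by (simp add: act_powr [OF \<open>t > 0\<close>])
    qed
    moreover have "(\<sigma> * (1 - of_real t * w)) ^ 2 = (1 - of_real t * w) ^ 2"
      using assms by (simp add: power_mult_distrib)
    moreover have "a * (2 - a) + (1 - a) ^ 2 = 1" for a :: complex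
      by (simp add: algebra_simps power2_eq_square)
    ultimately have "f (of_real (t powr (q / N)) * (exp (of_nat q * twist N K L) * x),
        of_real (t powr (p / N)) * (exp (of_nat p * twist N K L) * y)) + (\<sigma> * (1 - of_real t * w)) ^ 2 = 1"
      by (simp only:)
    moreover have "Re (\<sigma> * (\<sigma> * (1 - of_real t * w))) > -1"
      using half(1) [OF u t] by (simp only: z(2) xyz snd_conv flip: w_def) simp
    ultimately show ?thesis
      by (simp only: cap_def susp_def xyz fst_conv snd_conv mem_Collect_eq flip: w_def L_def)
  qed
  have at0: "?h (0, u) = (0, 0, \<sigma>)" for u
    by simp
  have at1: "?h (1, u) = u" if "u \<in> cap \<sigma>" for u
    using notneg [OF that, of 1] assms by (simp add: prod_eq_iff power2_eq_square flip: mult.assoc)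
  let ?S = "{0..1::real} \<times> cap \<sigma>"
  have ratio: "(2 - of_real (fst y) * ?w (snd y)) / (2 - ?w (snd y)) \<notin> \<real>\<^sub>\<le>\<^sub>0" and denom: "2 - ?w (snd y) \<noteq> 0" if "y \<in> ?S" for y
    using notneg [of "snd y" "fst y"] that by auto
  define L where "L y = ?l (fst y) (snd y)" for y
  define P where "P n y = fst y powr (n / N)" for n :: nat and y :: "real \<times> complex3"
  have "continuous_on ?S L"
    unfolding L_def by (intro continuous_intros ballI denom ratio)
  \<comment> \<open>Continuity at \<open>t = 0\<close> rests on the positive exponent
    \<open>n / N\<close>.\<close>
  moreover have "continuous_on ?S (P n)" if "n > 0" for n
    unfolding P_def using that pos by (intro continuous_on_powr' continuous_intros) auto
  ultimately have "continuous_on ?S (\<lambda>y. (of_real (P q y) * (exp (of_nat q * twist N K (L y)) * fst (snd y)),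
      of_real (P p y) * (exp (of_nat p * twist N K (L y)) * fst (snd (snd y))),
      \<sigma> * (1 - of_real (fst y) * ?w (snd y))))"
    using pos by (intro continuous_intros)
  then have "continuous_on ?S ?h"
    by (simp only: P_def L_def)
  then have ch: "continuous_map (prod_topology (top_of_set {0..1}) (top_of_set (cap \<sigma>))) (top_of_set (cap \<sigma>)) ?h"
    unfolding prod_topology_subtopology_eu continuous_map_subtopology_eu using into by auto
  have "homotopic_with (\<lambda>x. True) (top_of_set (cap \<sigma>)) (top_of_set (cap \<sigma>)) (\<lambda>u. (0, 0, \<sigma>)) id"
  proof (subst homotopic_with, simp, intro exI conjI ballI)
    show "continuous_map (prod_topology (top_of_set {0..1}) (top_of_set (cap \<sigma>))) (top_of_set (cap \<sigma>)) ?h"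
      by (rule ch)
  qed (use at0 at1 in \<open>simp_all only: topspace_euclidean_subtopology id_apply\<close>)
  then show ?thesis
    unfolding contractible_def using homotopic_with_symD by blast
qed

lemma openin_cap: "openin (top_of_set susp) (cap \<sigma>)"
proof -
  have "cap \<sigma> = {u \<in> susp. Re (\<sigma> * snd (snd u)) + 1 > 0}" by (auto simp: cap_def)
  then show ?thesis
    by (auto intro!: openin_half_space continuous_intros)
qed

text \<open>On the overlap \<open>Re z\<close> lies strictly between \<open>-1\<close> and
  \<open>1\<close>, so \<open>f = 1 - z ^ 2\<close> has positive real part and the action can
  normalise it to 1 through a continuous logarithm. Scaling \<open>z\<close> towards 0 keeps this
  property, and the difference of two logarithms adjusts \<open>f\<close> on the way.\<close>

lemma belt_homotopy_equivalent:
  "top_of_set (cap 1 \<inter> cap (-1)) homotopy_equivalent_space top_of_set fibre"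
proof -
  let ?W = "cap 1 \<inter> cap (-1)"
  let ?z = "\<lambda>u::complex3. snd (snd u)" and ?v = "\<lambda>u::complex3. (fst u, fst (snd u))"
  let ?a = "\<lambda>u. act (- Ln (1 - ?z u ^ 2)) (?v u)"
  let ?b = "\<lambda>v::complex \<times> complex. (fst v, snd v, 0::complex)"
  let ?c = "\<lambda>y. act (Ln (1 - (of_real (fst y) * ?z (snd y)) ^ 2) - Ln (1 - ?z (snd y) ^ 2)) (?v (snd y))"
  let ?h = "\<lambda>y::real \<times> complex3. (fst (?c y), snd (?c y), of_real (fst y) * ?z (snd y))"
  have W: "f (?v u) = 1 - ?z u ^ 2" "\<bar>Re (?z u)\<bar> < 1" if "u \<in> ?W" for u
    using that by (auto simp: cap_def susp_def algebra_simps)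
  have pos1: "Re (1 - (of_real t * z) ^ 2) > 0" if "0 \<le> t" "t \<le> 1" "\<bar>Re z\<bar> < 1" for t and z :: complex
  proof -
    have "\<bar>t * Re z\<bar> \<le> \<bar>Re z\<bar>"
      using that by (simp add: abs_mult mult_left_le_one_le)
    then have "(t * Re z) ^ 2 < 1"
      using that by (simp add: abs_square_less_1)
    moreover have "Re ((of_real t * z) ^ 2) \<le> (t * Re z) ^ 2"
      by (simp add: power2_eq_square)
    ultimately show ?thesis by simp
  qed
  have slit: "1 - (of_real t * ?z u) ^ 2 \<notin> \<real>\<^sub>\<le>\<^sub>0" "1 - (of_real t * ?z u) ^ 2 \<noteq> 0" if "u \<in> ?W" "0 \<le> t" "t \<le> 1" for t u
    using pos1 [OF that(2,3) W(2) [OF that(1)]] by (force simp: complex_nonpos_Reals_iff)+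
  have slit1: "1 - ?z u ^ 2 \<notin> \<real>\<^sub>\<le>\<^sub>0" "1 - ?z u ^ 2 \<noteq> 0" if "u \<in> ?W" for u
    using slit [OF that, of 1] by auto
  have "continuous_on ?W ?a"
    using slit1 by (intro continuous_intros) auto
  moreover have "?a \<in> ?W \<rightarrow> fibre"
    using W slit1 by (auto simp: fibre_def exp_minus)
  ultimately have ca: "continuous_map (top_of_set ?W) (top_of_set fibre) ?a"
    by simp
  have "continuous_on fibre ?b"
    by (intro continuous_intros)
  moreover have "?b \<in> fibre \<rightarrow> ?W"
    by (auto simp: fibre_def cap_def susp_def)
  ultimately have cb: "continuous_map (top_of_set fibre) (top_of_set ?W) ?b"
    by simp
  have "continuous_on ({0..1} \<times> ?W) ?h"
    using slit slit1 by (intro continuous_intros) auto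
  moreover have "?h (t, u) \<in> ?W" if "0 \<le> t" "t \<le> 1" "u \<in> ?W" for t u
  proof -
    have "f (?c (t, u)) = 1 - (of_real t * ?z u) ^ 2"
      using slit [OF that(3,1,2)] slit1 [OF that(3)] W [OF that(3)] by (simp add: exp_diff)
    moreover have "\<bar>t * Re (?z u)\<bar> < 1"
      using that W [OF that(3)] by (metis abs_mult abs_of_nonneg abs_ge_zero mult_left_le_one_le order_le_less_trans)
    ultimately show ?thesis
      using that by (auto simp: cap_def susp_def)
  qed
  ultimately have ch: "continuous_map (prod_topology (top_of_set {0..1}) (top_of_set ?W)) (top_of_set ?W) ?h"
    unfolding prod_topology_subtopology_eu continuous_map_subtopology_eu by auto
  have "homotopic_with (\<lambda>x. True) (top_of_set ?W) (top_of_set ?W) (?b \<circ> ?a) id"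
    by (subst homotopic_with) (use ch in \<open>auto intro!: exI [of _ ?h]\<close>)
  moreover have "homotopic_with (\<lambda>x. True) (top_of_set fibre) (top_of_set fibre) (?a \<circ> ?b) id"
    by (rule homotopic_with_equal) (use continuous_map_compose [OF cb ca] in auto)
  ultimately show ?thesis
    unfolding homotopy_equivalent_space_def using ca cb by blast
qed

lemma second_homology_susp: "homology_group 2 (top_of_set susp) \<cong> homology_group 1 (top_of_set fibre)"
proof -
  have sub: "cap \<sigma> \<subseteq> susp" for \<sigma> by (auto simp: cap_def)
  have "homology_group (1 + 1) (top_of_set susp) \<cong> homology_group 1 (subtopology (top_of_set susp) (cap 1 \<inter> cap (-1)))"
  proof (rule homology_suspension_open_cover)
    show "cap 1 \<union> cap (-1) = topspace (top_of_set susp)"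
      by (auto simp: cap_def)
    show "cap 1 \<inter> cap (-1) \<noteq> {}"
    proof -
      obtain v where "v \<in> fibre" using fibre_nonempty by blast
      then have "(fst v, snd v, 0) \<in> cap 1 \<inter> cap (-1)"
        by (simp add: fibre_def cap_def susp_def)
      then show ?thesis by blast
    qed
    show "contractible_space (subtopology (top_of_set susp) (cap 1))"
      "contractible_space (subtopology (top_of_set susp) (cap (-1)))"
      using contractible_cap sub by (auto simp: subtopology_subtopology Int_absorb1)
  qed (auto simp: openin_cap)
  also have "subtopology (top_of_set susp) (cap 1 \<inter> cap (-1)) = top_of_set (cap 1 \<inter> cap (-1))"
    using sub by (metis Int_absorb1 inf.coboundedI1 subtopology_subtopology)
  also have "homology_group 1 \<dots> \<cong> homology_group 1 (top_of_set fibre)"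
    by (intro homotopy_equivalent_space_imp_isomorphic_homology_groups belt_homotopy_equivalent)
  finally show ?thesis by simp
qed

section \<open>Monomial coordinates: the fibre as a cyclic cover\<close>

text \<open>\<open>(s, w) \<mapsto> (s\<^sup>q w\<^sup>a, s\<^sup>p w\<^sup>b)\<close> is an automorphism of the torus \<open>(\<complex> - {0})\<^sup>2\<close>, since its exponent
  matrix has determinant \<open>1\<close>; the second coordinate is the quotient by the action.\<close>

lemma fibre_homotopy_equivalent_cyclic_cover:
  assumes det: "q * b = p * a + 1"
    and torus: "\<And>x y. f (x, y) \<noteq> 0 \<Longrightarrow> x \<noteq> 0 \<and> y \<noteq> 0"
    and form: "\<And>s w. s \<noteq> 0 \<Longrightarrow> w \<noteq> 0 \<Longrightarrow> sgn (f (s ^ q * w ^ a, s ^ p * w ^ b)) = sgn (s ^ K * w ^ c * (1 + w))"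
  shows "top_of_set fibre homotopy_equivalent_space top_of_set (cyclic_cover K c)"
proof -
  \<comment> \<open>A \<open>K\<close>-th root of \<open>(-1) ^ c\<close>, absorbing the sign caused
    by \<open>w = - v\<close>; that substitution turns \<open>1 + w\<close> into
    \<open>1 - v\<close> and moves the puncture to 1.\<close>
  define \<zeta> where "\<zeta> = exp (\<i> * of_real (pi * c / K))"
  have "\<zeta> \<noteq> 0" by (simp add: \<zeta>_def)
  have \<zeta>K: "\<zeta> ^ K = (-1) ^ c"
  proof -
    have "\<zeta> ^ K = exp (of_nat K * (\<i> * of_real (pi * c / K)))"
      by (simp only: \<zeta>_def exp_of_nat_mult)
    also have "of_nat K * (\<i> * of_real (pi * c / K)) = of_nat c * (\<i> * of_real pi)"
      using pos by simp
    also have "exp \<dots> = (-1) ^ c"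
      by (simp only: exp_of_nat_mult) simp
    finally show ?thesis .
  qed
  let ?T = "cyclic_cover K c"
  let ?g = "\<lambda>t :: complex \<times> complex. ((\<zeta> * fst t) ^ q * (- snd t) ^ a, (\<zeta> * fst t) ^ p * (- snd t) ^ b)"
  \<comment> \<open>Over the cover \<open>f (?g t)\<close> is a positive real, so the real flow for
    this time brings it to 1.\<close>
  define \<rho> where "\<rho> t = - ln (cmod (f (?g t)))" for t
  let ?G = "\<lambda>t. act (of_real (\<rho> t)) (?g t)"
  \<comment> \<open>Inverse monomial map: the matrix with rows \<open>(q, a)\<close> and
    \<open>(p, b)\<close> has inverse with rows \<open>(b, -a)\<close> and
    \<open>(-p, q)\<close>.\<close>
  let ?F = "\<lambda>v :: complex \<times> complex. (fst v ^ b / (\<zeta> * snd v ^ a), - (snd v ^ q / fst v ^ p))"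
  have T: "fst t \<noteq> 0 \<and> snd t \<noteq> 0 \<and> sgn (f (?g t)) = 1" if "t \<in> ?T" for t
  proof -
    obtain s v where t: "t = (s, v)" by force
    then have sv: "v \<noteq> 0" "sgn (s ^ K * v ^ c * (1 - v)) = 1"
      using that by (auto simp: cyclic_cover_def)
    then have "s \<noteq> 0" using pos by (auto simp: zero_power)
    have "sgn (f (?g t)) = sgn ((\<zeta> * s) ^ K * (- v) ^ c * (1 - v))"
      using form [of "\<zeta> * s" "- v"] \<open>s \<noteq> 0\<close> \<open>\<zeta> \<noteq> 0\<close> sv by (simp add: t)
    also have "(\<zeta> * s) ^ K * (- v) ^ c * (1 - v) = ((-1) ^ c * (-1) ^ c) * (s ^ K * v ^ c * (1 - v))"
      by (subst power_minus [of v]) (simp add: power_mult_distrib \<zeta>K)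
    also have "\<dots> = s ^ K * v ^ c * (1 - v)"
      by (simp flip: power_mult_distrib)
    finally show ?thesis
      using sv \<open>s \<noteq> 0\<close> by (simp add: t)
  qed
  have G: "f (?G t) = 1" if "t \<in> ?T" for t
  proof -
    define z where "z = f (?g t)"
    have "sgn z = 1" using T [OF that] by (simp add: z_def)
    then have "z \<noteq> 0" by auto
    have "f (?G t) = exp (of_real (- ln (cmod z))) * z"
      by (simp only: f_act z_def \<rho>_def)
    also have "\<dots> = z / of_real (cmod z)"
      using \<open>z \<noteq> 0\<close> by (simp add: exp_minus exp_of_real divide_inverse)
    also have "\<dots> = 1"
      using \<open>sgn z = 1\<close> by (simp add: sgn_eq)
    finally show ?thesis .
  qed
  have gF: "?g (?F v) = v" if "f v \<noteq> 0" for v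
  proof -
    obtain x y where v: "v = (x, y)" by force
    then have "f (x, y) \<noteq> 0" using that by simp
    from torus [OF this] have nz: "x \<noteq> 0" "y \<noteq> 0" by blast+
    have p1: "z ^ (q * b) = z ^ (p * a) * z" "z ^ (b * q) = z ^ (a * p) * z" for z :: complex
      using det by (simp_all add: power_add mult.commute)
    have "(x ^ b / y ^ a) ^ q * (y ^ q / x ^ p) ^ a = x"
      using nz by (simp add: power_divide p1 flip: power_mult) (simp add: mult.commute)
    moreover have "(x ^ b / y ^ a) ^ p * (y ^ q / x ^ p) ^ b = y"
      using nz by (simp add: power_divide p1 flip: power_mult) (simp add: mult.commute)
    ultimately show ?thesis
      using \<open>\<zeta> \<noteq> 0\<close> by (simp add: v)
  qed
  have F: "?F v \<in> ?T" if "v \<in> fibre" for v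
  proof -
    obtain x y where v: "v = (x, y)" by force
    have f1: "f v = 1" using that by (simp add: fibre_def)
    then have "f (x, y) \<noteq> 0" using v by simp
    from torus [OF this] have nz: "x \<noteq> 0" "y \<noteq> 0" by blast+
    define s w where "s = x ^ b / y ^ a" and "w = y ^ q / x ^ p"
    have sw: "s \<noteq> 0" "w \<noteq> 0" using nz by (auto simp: s_def w_def)
    have "(s ^ q * w ^ a, s ^ p * w ^ b) = v"
      using gF [of v] f1 \<open>\<zeta> \<noteq> 0\<close> by (simp add: v s_def w_def)
    then have "sgn (s ^ K * w ^ c * (1 + w)) = 1"
      using form [OF sw] f1 by simp
    moreover have "(s / \<zeta>) ^ K * (- w) ^ c * (1 - - w) = s ^ K * w ^ c * (1 + w)"
      by (subst power_minus [of w]) (simp add: power_divide \<zeta>K)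
    ultimately have "sgn ((s / \<zeta>) ^ K * (- w) ^ c * (1 - - w)) = 1"
      by (simp only:)
    then have "(s / \<zeta>, - w) \<in> ?T"
      using sw by (simp add: cyclic_cover_def)
    then show ?thesis
      by (simp add: v s_def w_def mult.commute)
  qed
  \<comment> \<open>Under the action \<open>w\<close> has weight 0 and \<open>s\<close> weight 1, so
    the round trip merely rescales \<open>s\<close> by a positive number; the homotopy
    \<open>?h\<close> below undoes this inside the cover.\<close>
  have FG: "?F (?G t) = (exp (of_real (\<rho> t / N)) * fst t, snd t)" if "t \<in> ?T" for t
  proof -
    obtain s v where t: "t = (s, v)" by force
    define E where "E = exp (of_real (\<rho> t / N) :: complex)"
    define S w where "S = \<zeta> * s" and "w = - v"
    have nz: "S \<noteq> 0" "w \<noteq> 0" "E \<noteq> 0"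
      using T [OF that] \<open>\<zeta> \<noteq> 0\<close> by (auto simp: t S_def w_def E_def)
    have eE: "exp (of_nat n * twist N K (of_real (\<rho> t))) = E ^ n" for n
      by (simp only: twist_of_real exp_of_nat_mult E_def)
    have Gt: "?G t = (E ^ q * (S ^ q * w ^ a), E ^ p * (S ^ p * w ^ b))"
      by (simp only: act_def fst_conv snd_conv eE) (simp add: t S_def w_def)
    have p1: "z ^ (q * b) = z ^ (p * a) * z" for z :: complex
      using det by (simp add: power_add)
    have c1: "(E ^ q * (S ^ q * w ^ a)) ^ b / (E ^ p * (S ^ p * w ^ b)) ^ a = E * S"
      using nz by (simp add: power_mult_distrib p1 flip: power_mult) (simp add: mult.commute)
    have c2: "(E ^ p * (S ^ p * w ^ b)) ^ q / (E ^ q * (S ^ q * w ^ a)) ^ p = w"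
    proof -
      have "w ^ (b * q) = w ^ (a * p) * w"
        using p1 [of w] by (simp add: mult.commute)
      then show ?thesis
        using nz by (simp add: power_mult_distrib flip: power_mult) (simp add: mult.commute)
    qed
    have "x / (\<zeta> * y) = x / y / \<zeta>" for x y
      by (simp add: mult.commute)
    then have "?F (?G t) = (E * S / \<zeta>, - w)"
      by (simp only: Gt fst_conv snd_conv c1 c2)
    then show ?thesis
      using \<open>\<zeta> \<noteq> 0\<close> by (simp add: S_def w_def t E_def)
  qed
  have "continuous_on ?T ?g"
    by (intro continuous_intros)
  then have cont_\<rho>: "continuous_on ?T \<rho>"
    unfolding \<rho>_def using T by (intro continuous_intros) (auto dest!: T)
  have "continuous_on ?T ?G"
    by (intro continuous_intros cont_\<rho>)
  then have cG: "continuous_map (top_of_set ?T) (top_of_set fibre) ?G"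
    using G by (auto simp: fibre_def)
  have nz: "fst v \<noteq> 0 \<and> snd v \<noteq> 0" if "v \<in> fibre" for v
    using torus [of "fst v" "snd v"] that unfolding fibre_def prod.collapse by simp
  have "continuous_on fibre ?F"
    using nz \<open>\<zeta> \<noteq> 0\<close> by (intro continuous_intros) auto
  then have cF: "continuous_map (top_of_set fibre) (top_of_set ?T) ?F"
    using F by auto
  have "homotopic_with (\<lambda>x. True) (top_of_set fibre) (top_of_set fibre) (?G \<circ> ?F) id"
  proof (rule homotopic_with_equal)
    show "continuous_map (top_of_set fibre) (top_of_set fibre) (?G \<circ> ?F)"
      by (rule continuous_map_compose [OF cF cG])
    show "(?G \<circ> ?F) v = id v" if "v \<in> topspace (top_of_set fibre)" for v
    proof -
      have "f v = 1" using that by (simp add: fibre_def)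
      then have "?g (?F v) = v" by (intro gF) simp
      then show ?thesis
        using \<open>f v = 1\<close> by (simp only: o_def \<rho>_def) simp
    qed
  qed auto
  moreover have "homotopic_with (\<lambda>x. True) (top_of_set ?T) (top_of_set ?T) (?F \<circ> ?G) id"
  proof -
    let ?h = "\<lambda>y. (exp (of_real ((1 - fst y) * (\<rho> (snd y) / N))) * fst (snd y), snd (snd y))"
    have "continuous_on ({0..1} \<times> ?T) (\<lambda>y. \<rho> (snd y))"
      by (rule continuous_on_compose2 [OF cont_\<rho>]) (auto intro: continuous_intros)
    then have "continuous_on ({0..1} \<times> ?T) ?h"
      using pos by (intro continuous_intros) auto
    moreover have "?h (u, t) \<in> ?T" if "t \<in> ?T" for u t
    proof -
      define r where "r = exp ((1 - u) * (\<rho> t / N))"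
      have "r > 0" by (simp add: r_def)
      have "(of_real r * fst t) ^ K * snd t ^ c * (1 - snd t) = of_real (r ^ K) * (fst t ^ K * snd t ^ c * (1 - snd t))"
        by (simp add: power_mult_distrib)
      also have "sgn \<dots> = 1"
        using that \<open>r > 0\<close> by (auto simp: cyclic_cover_def sgn_mult sgn_power_complex sgn_of_real)
      finally have "(of_real r * fst t, snd t) \<in> ?T"
        using that by (auto simp: cyclic_cover_def)
      then show ?thesis
        by (simp only: r_def fst_conv snd_conv exp_of_real)
    qed
    ultimately have ch: "continuous_map (prod_topology (top_of_set {0..1}) (top_of_set ?T)) (top_of_set ?T) ?h"
      unfolding prod_topology_subtopology_eu continuous_map_subtopology_eu by fastforce
    have h0: "?h (0, t) = (?F \<circ> ?G) t" if "t \<in> ?T" for t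
      using FG [OF that] by (simp only: o_def) simp
    have h1: "?h (1, t) = id t" for t
      by simp
    show ?thesis
    proof (subst homotopic_with, simp, intro exI conjI ballI)
      show "continuous_map (prod_topology (top_of_set {0..1}) (top_of_set ?T)) (top_of_set ?T) ?h"
        by (rule ch)
    qed (use h0 h1 in \<open>simp_all only: topspace_euclidean_subtopology\<close>)
  qed
  ultimately show ?thesis
    unfolding homotopy_equivalent_space_def using cF cG by blast
qed

lemma second_homology_susp_free:
  assumes "q * b = p * a + 1" "\<And>x y. f (x, y) \<noteq> 0 \<Longrightarrow> x \<noteq> 0 \<and> y \<noteq> 0"
    and "\<And>s w. s \<noteq> 0 \<Longrightarrow> w \<noteq> 0 \<Longrightarrow> sgn (f (s ^ q * w ^ a, s ^ p * w ^ b)) = sgn (s ^ K * w ^ c * (1 + w))"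
  shows "\<exists>\<U> :: (complex \<times> complex) set set. finite \<U> \<and> card \<U> = K + 1 \<and>
    homology_group 2 (top_of_set susp) \<cong> free_Abelian_group \<U>"
proof -
  have "homology_group 1 (top_of_set fibre) \<cong> homology_group 1 (top_of_set (cyclic_cover K c))"
    by (rule homotopy_equivalent_space_imp_isomorphic_homology_groups
        [OF fibre_homotopy_equivalent_cyclic_cover [OF assms]])
  from iso_trans [OF second_homology_susp this] show ?thesis
    using first_homology_cyclic_cover [OF pos(4), of c] by (meson iso_trans)
qed

end

section \<open>Pages of the Milnor fibration and the affine fibre\<close>

text \<open>Monotonicity makes \<open>g s v < e\<close> equivalent to \<open>s < \<tau> v\<close>,
  and dually. Continuity of \<open>g s\<close> for each fixed \<open>s\<close> thus gives both
  semicontinuities of \<open>\<tau>\<close>.\<close>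

lemma continuous_on_implicit_increasing:
  fixes \<tau> :: "'a::topological_space \<Rightarrow> real" and g :: "real \<Rightarrow> 'a \<Rightarrow> real"
  assumes cont: "\<And>t. continuous_on S (g t)"
    and mono: "\<And>s t v. v \<in> S \<Longrightarrow> s < t \<Longrightarrow> g s v < g t v"
    and sol: "\<And>v. v \<in> S \<Longrightarrow> g (\<tau> v) v = e"
  shows "continuous_on S \<tau>"
proof -
  have iff: "(g s v < e) = (s < \<tau> v)" "(e < g s v) = (\<tau> v < s)" if "v \<in> S" for s v
    using mono [OF that, of s "\<tau> v"] mono [OF that, of "\<tau> v" s] sol [OF that]
    by (cases s "\<tau> v" rule: linorder_cases; force)+
  show ?thesis
    unfolding continuous_on_def
  proof (intro ballI order_tendstoI)
    fix v a assume v: "v \<in> S"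
    have lim: "(g a \<longlongrightarrow> g a v) (at v within S)"
      using cont v by (simp add: continuous_on_def)
    have near: "\<forall>\<^sub>F w in at v within S. w \<in> S"
      by (simp add: eventually_at_filter)
    show "\<forall>\<^sub>F w in at v within S. a < \<tau> w" if "a < \<tau> v"
    proof -
      have "\<forall>\<^sub>F w in at v within S. g a w < e"
        using order_tendstoD(2) [OF lim] iff [OF v] that by blast
      with near show ?thesis
        by eventually_elim (simp add: iff)
    qed
    show "\<forall>\<^sub>F w in at v within S. \<tau> w < a" if "\<tau> v < a"
    proof -
      have "\<forall>\<^sub>F w in at v within S. e < g a w"
        using order_tendstoD(1) [OF lim] iff [OF v] that by blast
      with near show ?thesis
        by eventually_elim (simp add: iff)
    qed
  qed
qed

context polar_weighted
begin

definition H :: "complex3 \<Rightarrow> complex" where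
  "H u = f (fst u, fst (snd u)) + (snd (snd u)) ^ 2"

lemma susp_eq: "susp = {u. H u = 1}"
  by (simp add: susp_def H_def)

text \<open>The factor \<open>exp (l / 2)\<close> on \<open>z\<close> makes \<open>z ^ 2\<close>
  scale by \<open>exp l\<close>, as \<open>f\<close> does.\<close>

definition act3 :: "complex \<Rightarrow> complex3 \<Rightarrow> complex3" where
  "act3 l u = (exp (of_nat q * twist N K l) * fst u, exp (of_nat p * twist N K l) * fst (snd u), exp (l / 2) * snd (snd u))"

lemma H_act3: "H (act3 l u) = exp l * H u"
proof -
  have "exp (l / 2) ^ 2 = exp l"
    by (simp add: exp_double [symmetric])
  then show ?thesis
    using weighted by (simp add: H_def act3_def power_mult_distrib distrib_left)
qed

lemma act3_add: "act3 (l + m) u = act3 l (act3 m u)"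
  by (simp add: act3_def twist_add distrib_left exp_add add_divide_distrib)

lemma act3_0 [simp]: "act3 0 u = u"
  by (simp add: act3_def)

lemma act3_eq_0_iff [simp]: "act3 l u = 0 \<longleftrightarrow> u = 0"
  by (auto simp: act3_def prod_eq_iff)

lemma continuous_on_act3 [continuous_intros]:
  "continuous_on S l \<Longrightarrow> continuous_on S v \<Longrightarrow> continuous_on S (\<lambda>x. act3 (l x) (v x))"
  unfolding act3_def divide_inverse [of _ 2] by (intro continuous_intros)

lemma continuous_on_H [continuous_intros]:
  "continuous_on S v \<Longrightarrow> continuous_on S (\<lambda>x. H (v x))"
  unfolding H_def by (intro continuous_intros)

lemma norm_act3:
  fixes t :: real
  shows "norm (act3 (of_real t) u) ^ 2 =
    exp (2 * (q * t / N)) * cmod (fst u) ^ 2 + exp (2 * (p * t / N)) * cmod (fst (snd u)) ^ 2 + exp t * cmod (snd (snd u)) ^ 2"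
proof -
  have "of_nat n * twist N K (of_real t) = of_real (n * t / N)" for n :: nat
    by (simp add: twist_of_real)
  moreover have "of_real t / 2 = (of_real (t / 2) :: complex)" by simp
  moreover have "exp x ^ 2 = exp (2 * x)" for x :: real
    by (simp add: exp_double)
  ultimately show ?thesis
    by (simp add: act3_def norm_Pair real_sqrt_pow2 norm_mult power_mult_distrib del: of_real_divide of_real_mult)
qed

lemma norm_act3_mono:
  fixes s t :: real
  assumes "u \<noteq> 0" "s < t"
  shows "norm (act3 (of_real s) u) < norm (act3 (of_real t) u)"
proof -
  have less: "exp (2 * (n * s / N)) < exp (2 * (n * t / N))" if "n > 0" for n :: nat
    using assms(2) that pos by (simp add: divide_strict_right_mono)
  have l: "exp (2 * (q * s / N)) * cmod (fst u) ^ 2 \<le> exp (2 * (q * t / N)) * cmod (fst u) ^ 2"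
    "exp (2 * (p * s / N)) * cmod (fst (snd u)) ^ 2 \<le> exp (2 * (p * t / N)) * cmod (fst (snd u)) ^ 2"
    "exp s * cmod (snd (snd u)) ^ 2 \<le> exp t * cmod (snd (snd u)) ^ 2"
    using less pos assms(2) by (auto intro!: mult_right_mono simp: less_imp_le)
  have l': "fst u \<noteq> 0 \<Longrightarrow> exp (2 * (q * s / N)) * cmod (fst u) ^ 2 < exp (2 * (q * t / N)) * cmod (fst u) ^ 2"
    "fst (snd u) \<noteq> 0 \<Longrightarrow> exp (2 * (p * s / N)) * cmod (fst (snd u)) ^ 2 < exp (2 * (p * t / N)) * cmod (fst (snd u)) ^ 2"
    "snd (snd u) \<noteq> 0 \<Longrightarrow> exp s * cmod (snd (snd u)) ^ 2 < exp t * cmod (snd (snd u)) ^ 2"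
    using less pos assms(2) by (auto intro!: mult_strict_right_mono)
  have "fst u \<noteq> 0 \<or> fst (snd u) \<noteq> 0 \<or> snd (snd u) \<noteq> 0"
    using assms(1) by (auto simp: prod_eq_iff)
  then have "norm (act3 (of_real s) u) ^ 2 < norm (act3 (of_real t) u) ^ 2"
  proof (elim disjE)
    show "norm (act3 (of_real s) u) ^ 2 < norm (act3 (of_real t) u) ^ 2" if "fst u \<noteq> 0"
      unfolding norm_act3 using l'(1) [OF that] l by linarith
    show "norm (act3 (of_real s) u) ^ 2 < norm (act3 (of_real t) u) ^ 2" if "fst (snd u) \<noteq> 0"
      unfolding norm_act3 using l'(2) [OF that] l by linarith
    show "norm (act3 (of_real s) u) ^ 2 < norm (act3 (of_real t) u) ^ 2" if "snd (snd u) \<noteq> 0"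
      unfolding norm_act3 using l'(3) [OF that] l by linarith
  qed
  then show ?thesis
    by (simp add: power2_less_imp_less)
qed

text \<open>Each nonzero coordinate contributes an exponential of positive rate to the squared norm,
  which therefore tends to 0 backwards and is unbounded forwards. With
  \<open>norm_act3_mono\<close>, each nonzero orbit of the real flow crosses every sphere exactly
  once, which is why every radius is allowed.\<close>

lemma norm_act3_solution:
  assumes "u \<noteq> 0" "\<epsilon> > 0"
  shows "\<exists>t. norm (act3 (of_real t) u) = \<epsilon>"
proof -
  let ?g = "\<lambda>t. norm (act3 (of_real t) u) ^ 2"
  have lim0: "((\<lambda>t. exp (r * t) * c) \<longlongrightarrow> 0) at_bot" if "r > 0" for r c :: real
    using that by real_asymp
  have eq: "?g t = exp ((2 * q / N) * t) * cmod (fst u) ^ 2 + exp ((2 * p / N) * t) * cmod (fst (snd u)) ^ 2 + exp (1 * t) * cmod (snd (snd u)) ^ 2" for t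
    by (simp add: norm_act3 mult.assoc)
  have "(?g \<longlongrightarrow> 0 + 0 + 0) at_bot"
    unfolding eq using pos by (intro tendsto_add lim0) auto
  then have "\<forall>\<^sub>F t in at_bot. ?g t < \<epsilon> ^ 2"
    by (rule order_tendstoD(2)) (use assms in simp)
  then obtain a where a: "?g a < \<epsilon> ^ 2"
    using eventually_happens by fastforce
  have "\<exists>b. ?g b > \<epsilon> ^ 2"
  proof -
    have grow: "\<exists>b. exp (r * b) * c > \<epsilon> ^ 2" if "r > 0" "c > 0" for r c :: real
    proof -
      have "filterlim (\<lambda>b. exp (r * b) * c) at_top at_top"
        using that by real_asymp
      then have "\<forall>\<^sub>F b in at_top. \<epsilon> ^ 2 < exp (r * b) * c"
        by (simp add: filterlim_at_top_dense)
      then show ?thesis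
        by (auto dest!: eventually_happens)
    qed
    have "cmod (fst u) ^ 2 > 0 \<or> cmod (fst (snd u)) ^ 2 > 0 \<or> cmod (snd (snd u)) ^ 2 > 0"
      using assms(1) by (auto simp: prod_eq_iff)
    moreover have "2 * q / N > 0" "2 * p / N > 0"
      using pos by auto
    ultimately obtain b where "exp ((2 * q / N) * b) * cmod (fst u) ^ 2 > \<epsilon> ^ 2 \<or>
        exp ((2 * p / N) * b) * cmod (fst (snd u)) ^ 2 > \<epsilon> ^ 2 \<or> exp (1 * b) * cmod (snd (snd u)) ^ 2 > \<epsilon> ^ 2"
      using grow [of "2 * q / N" "cmod (fst u) ^ 2"] grow [of "2 * p / N" "cmod (fst (snd u)) ^ 2"]
        grow [of 1 "cmod (snd (snd u)) ^ 2"] by fastforce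
    moreover have "exp ((2 * q / N) * b) * cmod (fst u) ^ 2 \<ge> 0" "exp ((2 * p / N) * b) * cmod (fst (snd u)) ^ 2 \<ge> 0"
      "exp (1 * b) * cmod (snd (snd u)) ^ 2 \<ge> 0"
      by auto
    ultimately have "?g b > \<epsilon> ^ 2"
      unfolding eq by linarith
    then show ?thesis ..
  qed
  then obtain b where b: "?g b > \<epsilon> ^ 2" ..
  have ab: "norm (act3 (of_real a) u) < \<epsilon>" "\<epsilon> < norm (act3 (of_real b) u)"
    using a b assms by (auto simp: power2_less_imp_less)
  then have "a \<le> b"
    using norm_act3_mono [OF assms(1), of b a] by force
  moreover have "continuous_on {a..b} (\<lambda>t. norm (act3 (of_real t) u))"
    by (intro continuous_intros)
  ultimately show ?thesis
    using IVT' [of "\<lambda>t. norm (act3 (of_real t) u)" a \<epsilon> b] ab by fastforce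
qed

text \<open>The real flow changes only the modulus of \<open>H\<close>, never its direction. A page
  point is rotated back by \<open>l = Ln \<theta>\<close> and rescaled to \<open>H = 1\<close>;
  conversely, a point with \<open>H = 1\<close> is rotated to direction \<open>\<theta>\<close> and
  flowed to the sphere.\<close>

lemma page_homeomorphic_susp:
  assumes "\<epsilon> > 0" "cmod \<theta> = 1"
  shows "page H \<epsilon> \<theta> homeomorphic susp"
proof -
  define \<tau> where "\<tau> u = (SOME t. norm (act3 (of_real t) u) = \<epsilon>)" for u
  have \<tau>: "norm (act3 (of_real (\<tau> u)) u) = \<epsilon>" if "u \<noteq> 0" for u
    unfolding \<tau>_def using norm_act3_solution [OF that assms(1)] by (rule someI_ex)
  have \<tau>_unique: "t = \<tau> u" if "u \<noteq> 0" "norm (act3 (of_real t) u) = \<epsilon>" for t u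
    using norm_act3_mono [OF that(1), of t "\<tau> u"] norm_act3_mono [OF that(1), of "\<tau> u" t] \<tau> [OF that(1)] that(2)
    by (cases t "\<tau> u" rule: linorder_cases) auto
  have cont_\<tau>: "continuous_on (- {0}) \<tau>"
    by (rule continuous_on_implicit_increasing [where g = "\<lambda>t u. norm (act3 (of_real t) u)" and e = \<epsilon>])
      (auto intro!: continuous_intros simp: norm_act3_mono \<tau>)
  define l where "l = Ln \<theta>"
  have "\<theta> \<noteq> 0" using assms by auto
  then have l: "exp l = \<theta>" by (simp add: l_def)
  have page: "u \<in> page H \<epsilon> \<theta> \<longleftrightarrow> norm u = \<epsilon> \<and> H u \<noteq> 0 \<and> sgn (H u) = \<theta>" for u
    by (auto simp: page_def link_def milnor_map_def sgn_eq dist_norm)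
  let ?f = "\<lambda>u. act3 (- l + of_real (- ln (cmod (H u)))) u"
  let ?g = "\<lambda>u. act3 (of_real (\<tau> (act3 l u))) (act3 l u)"
  have H0: "H 0 = 0"
    using f_0 by (simp add: H_def zero_prod_def)
  have swap: "act3 l (act3 (- l + m) u) = act3 m u" for m u
    by (simp flip: act3_add)
  have swap': "act3 (- l + m) (act3 n (act3 l u)) = act3 (m + n) u" for m n u
    by (simp add: algebra_simps flip: act3_add)
  show ?thesis
  proof (rule homeomorphic_by_inverse)
    show "continuous_on (page H \<epsilon> \<theta>) ?f"
      by (intro continuous_intros) (auto simp: page)
    have "act3 l u \<noteq> 0" if "u \<in> susp" for u
      using that H0 by (auto simp: susp_eq)
    then have "continuous_on susp (\<lambda>u. \<tau> (act3 l u))"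
      by (intro continuous_on_compose2 [OF cont_\<tau>] continuous_intros) auto
    then show "continuous_on susp ?g"
      by (intro continuous_intros)
    show "?f u \<in> susp \<and> ?g (?f u) = u" if "u \<in> page H \<epsilon> \<theta>" for u
    proof
      have u: "norm u = \<epsilon>" "H u \<noteq> 0" "sgn (H u) = \<theta>" using that page by auto
      then have Hu: "H u = of_real (cmod (H u)) * \<theta>"
        by (auto simp: sgn_eq)
      have "H (?f u) = inverse \<theta> * of_real (inverse (cmod (H u))) * H u"
        using u by (simp add: H_act3 exp_diff exp_minus l exp_of_real divide_inverse)
      also have "\<dots> = 1"
        using u \<open>\<theta> \<noteq> 0\<close> by (subst (2) Hu) (simp add: field_simps)
      finally show "?f u \<in> susp" by (simp add: susp_eq)
      let ?r = "- ln (cmod (H u))"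
      have "u \<noteq> 0" using u H0 by auto
      have "norm (act3 (of_real (- ?r)) (act3 (of_real ?r) u)) = \<epsilon>"
        using u by (simp flip: act3_add)
      then have "\<tau> (act3 (of_real ?r) u) = - ?r"
        using \<tau>_unique \<open>u \<noteq> 0\<close> by (metis act3_eq_0_iff)
      then have "?g (?f u) = act3 (of_real (- ?r)) (act3 (of_real ?r) u)"
        by (simp only: swap)
      then show "?g (?f u) = u"
        by (simp flip: act3_add)
    qed
    show "?g u \<in> page H \<epsilon> \<theta> \<and> ?f (?g u) = u" if "u \<in> susp" for u
    proof
      have Hu: "H u = 1" using that by (simp add: susp_eq)
      then have "act3 l u \<noteq> 0" using H0 by auto
      let ?t = "\<tau> (act3 l u)"
      have Hg: "H (?g u) = of_real (exp ?t) * \<theta>"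
        using Hu by (simp add: H_act3 l exp_of_real)
      then show "?g u \<in> page H \<epsilon> \<theta>"
        using \<tau> [OF \<open>act3 l u \<noteq> 0\<close>] assms \<open>\<theta> \<noteq> 0\<close> by (simp add: page sgn_mult sgn_of_real) (simp add: sgn_eq)
      have "cmod (H (?g u)) = exp ?t"
        using Hg assms by (simp add: norm_mult)
      then have "?f (?g u) = act3 (- l + of_real (- ?t)) (?g u)"
        by simp
      also have "\<dots> = u"
        by (simp only: swap') simp
      finally show "?f (?g u) = u" .
    qed
  qed
qed

end

section \<open>Links and pages of \<open>F\<close> and \<open>G\<close>\<close>

lemma link_homeomorphic: "link (F p q) \<epsilon> homeomorphic link (G p q) \<epsilon>"
proof -
  \<comment> \<open>As \<open>sgn 0 = 0\<close>, \<open>u\<close> vanishes where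
    \<open>x * y = 0\<close>; on the links \<open>z\<close> is 0 there, so \<open>z * u\<close>
    still equals \<open>z\<close>.\<close>
  define u where "u v = sgn (fst v * fst (snd v))" for v :: complex3
  define \<Phi> where "\<Phi> v = (fst v, fst (snd v), snd (snd v) * u v)" for v
  define \<Psi> where "\<Psi> v = (fst v, fst (snd v), snd (snd v) * cnj (u v))" for v
  have Fv: "F p q v = cnj (fst v * fst (snd v)) * (fst v ^ p + fst (snd v) ^ q) + snd (snd v) ^ 2"
    and Gv: "G p q v = fst v * fst (snd v) * (fst v ^ p + fst (snd v) ^ q) + snd (snd v) ^ 2" for v
    by (auto simp: F_def G_def case_prod_unfold)
  have uu: "cnj (u v) * u v = 1" "cmod (u v) = 1" if "fst v * fst (snd v) \<noteq> 0" for v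
    using that cnj_sgn_eq_inverse [of "fst v * fst (snd v)"] by (auto simp: u_def sgn_zero_iff norm_sgn)
  have polar: "a = cnj a * sgn a ^ 2" "cnj a = a * cnj (sgn a) ^ 2" for a :: complex
  proof -
    have "sgn a * cnj a = of_real (cmod a)"
      by (cases "a = 0") (simp_all add: sgn_eq complex_norm_square [symmetric] power2_eq_square)
    moreover have "a = of_real (cmod a) * sgn a" by (simp add: sgn_eq)
    ultimately show 1: "a = cnj a * sgn a ^ 2"
      by (metis mult.assoc mult.commute power2_eq_square)
    from arg_cong [OF 1, of cnj] show "cnj a = a * cnj (sgn a) ^ 2"
      by simp
  qed
  have z0: "snd (snd v) = 0" if "v \<in> link (F p q) \<epsilon> \<or> v \<in> link (G p q) \<epsilon>" "fst v * fst (snd v) = 0" for v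
    using that by (auto simp: link_def Fv Gv)
  have \<Psi>\<Phi>: "\<Psi> (\<Phi> v) = v" "\<Phi> (\<Psi> v) = v" "norm (\<Phi> v) = norm v" "norm (\<Psi> v) = norm v"
    if "v \<in> link (F p q) \<epsilon> \<or> v \<in> link (G p q) \<epsilon>" for v
  proof -
    have "snd (snd v) * u v * cnj (u v) = snd (snd v)" "snd (snd v) * cnj (u v) * u v = snd (snd v)"
      "cmod (snd (snd v) * u v) = cmod (snd (snd v))"
      using uu [of v] z0 [OF that] by (cases "fst v * fst (snd v) = 0"; simp add: mult.assoc mult.commute norm_mult)+
    moreover have "u (\<Phi> v) = u v" "u (\<Psi> v) = u v"
      by (simp_all add: u_def \<Phi>_def \<Psi>_def)
    ultimately show "\<Psi> (\<Phi> v) = v" "\<Phi> (\<Psi> v) = v" "norm (\<Phi> v) = norm v" "norm (\<Psi> v) = norm v"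
      by (simp_all add: \<Phi>_def \<Psi>_def norm_prod_def norm_mult prod_eq_iff mult.assoc)
  qed
  have alg: "w ^ 2 * (a * g + z ^ 2) = a * w ^ 2 * g + (z * w) ^ 2" for a g w z :: complex
    by (simp add: algebra_simps power2_eq_square)
  \<comment> \<open>Multiplying by the square of \<open>u\<close> turns \<open>cnj (x * y)\<close>
    into \<open>x * y\<close>, while \<open>z ^ 2\<close> becomes the square of
    \<open>z * u\<close>.\<close>
  have G\<Phi>: "G p q (\<Phi> v) = u v ^ 2 * F p q v" for v
  proof -
    have "fst v * fst (snd v) * g = cnj (fst v * fst (snd v)) * u v ^ 2 * g" for g
      unfolding u_def by (rule arg_cong [where f = "\<lambda>b. b * g", OF polar(1)])
    then show ?thesis
      by (simp only: Fv Gv \<Phi>_def fst_conv snd_conv alg)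
  qed
  have F\<Psi>: "F p q (\<Psi> v) = cnj (u v) ^ 2 * G p q v" for v
  proof -
    have "cnj (fst v * fst (snd v)) * g = fst v * fst (snd v) * cnj (u v) ^ 2 * g" for g
      unfolding u_def by (rule arg_cong [where f = "\<lambda>b. b * g", OF polar(2)])
    then show ?thesis
      by (simp only: Fv Gv \<Psi>_def fst_conv snd_conv alg)
  qed
  \<comment> \<open>Where \<open>x * y = 0\<close> the bounded factor \<open>w\<close> may jump, but
    it multiplies \<open>z\<close>, which tends to 0.\<close>
  have cont: "continuous_on S (\<lambda>v. snd (snd v) * w v)"
    if S: "S = link (F p q) \<epsilon> \<or> S = link (G p q) \<epsilon>"
      and w: "continuous_on {v \<in> S. fst v * fst (snd v) \<noteq> 0} w" "\<And>v. cmod (w v) \<le> 1" for S w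
    unfolding continuous_on_def
  proof
    fix v assume v: "v \<in> S"
    have lim_z: "((\<lambda>v. snd (snd v)) \<longlongrightarrow> snd (snd v)) (at v within S)"
      by (intro tendsto_intros)
    show "((\<lambda>v. snd (snd v) * w v) \<longlongrightarrow> snd (snd v) * w v) (at v within S)"
    proof (cases "fst v * fst (snd v) = 0")
      case True
      then have "snd (snd v) = 0" using z0 [of v] v S by auto
      with lim_z have "((\<lambda>v. cmod (snd (snd v))) \<longlongrightarrow> 0) (at v within S)"
        by (simp add: tendsto_norm_zero)
      moreover have "cmod (snd (snd v) * w v) \<le> cmod (snd (snd v))" for v
        unfolding norm_mult by (intro mult_left_le w(2) norm_ge_zero)
      then have "\<forall>\<^sub>F v in at v within S. cmod (snd (snd v) * w v) \<le> cmod (snd (snd v))"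
        by (intro always_eventually allI)
      ultimately have "((\<lambda>v. snd (snd v) * w v) \<longlongrightarrow> 0) (at v within S)"
        by (rule Lim_null_comparison [rotated])
      then show ?thesis using \<open>snd (snd v) = 0\<close> by simp
    next
      case False
      let ?U = "{v :: complex3. fst v * fst (snd v) \<noteq> 0}"
      have "open ?U"
        by (intro open_Collect_neq continuous_intros)
      then have "at v within S = at v within {v \<in> S. fst v * fst (snd v) \<noteq> 0}"
        by (rule at_within_nhd [rotated]) (use False in auto)
      moreover have "(w \<longlongrightarrow> w v) (at v within {v \<in> S. fst v * fst (snd v) \<noteq> 0})"
        using w(1) v False unfolding continuous_on_def by blast
      ultimately show ?thesis
        using lim_z by (auto intro: tendsto_mult)
    qed
  qed
  show ?thesis
  proof (rule homeomorphic_by_inverse)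
    have u: "continuous_on {v \<in> S. fst v * fst (snd v) \<noteq> 0} u" for S
      unfolding u_def by (intro continuous_intros) auto
    have le1: "cmod (u v) \<le> 1" "cmod (cnj (u v)) \<le> 1" for v
      by (simp_all add: u_def norm_sgn)
    show "continuous_on (link (F p q) \<epsilon>) \<Phi>"
      unfolding \<Phi>_def by (intro continuous_on_Pair continuous_on_fst continuous_on_snd continuous_on_id cont u le1) simp
    show "continuous_on (link (G p q) \<epsilon>) \<Psi>"
      unfolding \<Psi>_def
      by (intro continuous_on_Pair continuous_on_fst continuous_on_snd continuous_on_id cont continuous_on_cnj u le1) simp
    show "\<Phi> v \<in> link (G p q) \<epsilon> \<and> \<Psi> (\<Phi> v) = v" if "v \<in> link (F p q) \<epsilon>" for v
      using that \<Psi>\<Phi> [of v] G\<Phi> by (auto simp: link_def)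
    show "\<Psi> v \<in> link (F p q) \<epsilon> \<and> \<Phi> (\<Psi> v) = v" if "v \<in> link (G p q) \<epsilon>" for v
      using that \<Psi>\<Phi> [of v] F\<Psi> by (auto simp: link_def)
  qed
qed

section \<open>Weights and second homology of the pages\<close>

lemma exp_twist_power: "exp (of_nat n * twist N K l) ^ m = exp (of_nat (m * n) * twist N K l)"
  by (simp add: mult.assoc exp_of_nat_mult)

lemma page_second_homology:
  assumes "p \<ge> 2" "q \<ge> 2" "gcd p q = 1" "\<epsilon> > 0" "cmod \<theta> = 1"
  shows "\<exists>\<U> :: (complex \<times> complex) set set. finite \<U> \<and> card \<U> = p * q + p + q + 1 \<and>
      homology_group 2 (top_of_set (page (G p q) \<epsilon> \<theta>)) \<cong> free_Abelian_group \<U>"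
    and "\<exists>\<U> :: (complex \<times> complex) set set. finite \<U> \<and> card \<U> = p * q - p - q + 1 \<and>
      homology_group 2 (top_of_set (page (F p q) \<epsilon> \<theta>)) \<cong> free_Abelian_group \<U>"
proof -
  obtain b a where ab: "q * b = p * a + 1"
    using bezout_nat [of q p] assms by (auto simp: gcd.commute)
  have "p \<noteq> q"
    using assms by auto
  \<comment> \<open>Positivity of the circle weight of \<open>F\<close>, which also makes the
    subtraction in \<open>p * q - p - q\<close> exact: distinct numbers at least 2 include one at
    least 3.\<close>
  then have pq: "p + q < p * q"
  proof -
    have "p \<ge> 3 \<or> q \<ge> 3" using assms \<open>p \<noteq> q\<close> by linarith
    then show ?thesis
    proof
      assume "p \<ge> 3"
      then obtain k m where "p = 3 + k" "q = 2 + m" using assms(2) le_Suc_ex by metis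
      then show ?thesis by (simp add: algebra_simps)
    next
      assume "q \<ge> 3"
      then obtain k m where "q = 3 + k" "p = 2 + m" using assms(1) le_Suc_ex by metis
      then show ?thesis by (simp add: algebra_simps)
    qed
  qed
  \<comment> \<open>Bezout makes the two exponents of \<open>w\<close> differ by exactly one, hence
    the factor \<open>1 + w\<close>.\<close>
  have tor: "(s ^ q * w ^ a) ^ p + (s ^ p * w ^ b) ^ q = s ^ (p * q) * w ^ (a * p) * (1 + w)" for s w :: complex
  proof -
    have "(w ^ b) ^ q = w ^ (a * p) * w"
      using ab by (metis mult.commute power_add power_mult power_one_right)
    then show ?thesis
      by (simp add: power_mult_distrib algebra_simps flip: power_mult)
  qed
  let ?g = "\<lambda>v :: complex \<times> complex. fst v * snd v * (fst v ^ p + snd v ^ q)"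
  interpret g: polar_weighted ?g p q "p * q + p + q" "p * q + p + q"
  proof
    show "0 < p" "0 < q" "0 < p * q + p + q" using assms by auto
    show "continuous_on UNIV ?g" by (intro continuous_intros)
    have "?g (1, 1) \<noteq> 0" by simp
    then show "\<exists>v. ?g v \<noteq> 0" by blast
    fix l x y
    let ?\<kappa> = "twist (p * q + p + q) (p * q + p + q) l"
    have "of_nat (p * q + p + q) * ?\<kappa> = l"
      using assms(1) by (simp add: twist_def complex_eq_iff del: of_nat_add of_nat_mult)
    then have "exp l = exp (of_nat q * ?\<kappa>) * exp (of_nat p * ?\<kappa>) * exp (of_nat (p * q) * ?\<kappa>)"
      by (simp flip: exp_add add: algebra_simps)
    then show "?g (exp (of_nat q * ?\<kappa>) * x, exp (of_nat p * ?\<kappa>) * y) = exp l * ?g (x, y)"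
      by (simp add: power_mult_distrib exp_twist_power algebra_simps)
  qed
  have "\<exists>\<U> :: (complex \<times> complex) set set. finite \<U> \<and> card \<U> = p * q + p + q + 1 \<and>
    homology_group 2 (top_of_set g.susp) \<cong> free_Abelian_group \<U>"
  proof (rule g.second_homology_susp_free [OF ab])
    show "x \<noteq> 0 \<and> y \<noteq> 0" if "?g (x, y) \<noteq> 0" for x y
      using that by auto
    show "sgn (?g (s ^ q * w ^ a, s ^ p * w ^ b)) = sgn (s ^ (p * q + p + q) * w ^ (a + b + a * p) * (1 + w))" for s w
      unfolding fst_conv snd_conv tor by (simp add: power_add ac_simps)
  qed
  moreover have "g.H = G p q"
    by (auto simp: g.H_def G_def fun_eq_iff)
  then have "homology_group 2 (top_of_set (page (G p q) \<epsilon> \<theta>)) \<cong> homology_group 2 (top_of_set g.susp)"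
    using g.page_homeomorphic_susp [OF assms(4,5)]
    by (simp add: homeomorphic_space_imp_isomorphic_homology_groups)
  ultimately show "\<exists>\<U> :: (complex \<times> complex) set set. finite \<U> \<and> card \<U> = p * q + p + q + 1 \<and>
      homology_group 2 (top_of_set (page (G p q) \<epsilon> \<theta>)) \<cong> free_Abelian_group \<U>"
    by (meson iso_trans)
  let ?f = "\<lambda>v :: complex \<times> complex. cnj (fst v * snd v) * (fst v ^ p + snd v ^ q)"
  interpret f: polar_weighted ?f p q "p * q + p + q" "p * q - p - q"
  proof
    show "0 < p" "0 < q" "0 < p * q + p + q" "0 < p * q - p - q" using assms pq by auto
    show "continuous_on UNIV ?f" by (intro continuous_intros)
    have "?f (1, 1) \<noteq> 0" by simp
    then show "\<exists>v. ?f v \<noteq> 0" by blast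
    fix l x y
    let ?\<kappa> = "twist (p * q + p + q) (p * q - p - q) l"
    have "p * q + p + q \<noteq> 0" "p * q - p - q \<noteq> 0"
      using pq assms(1) by auto
    then have "real (p * q + p + q) \<noteq> 0" "real (p * q - p - q) \<noteq> 0"
      by (metis of_nat_eq_0_iff)+
    then have "real (p * q + p + q) * Re ?\<kappa> = Re l" "real (p * q - p - q) * Im ?\<kappa> = Im l"
      by (simp_all add: twist_def del: of_nat_add of_nat_mult of_nat_diff)
    moreover have "real (p * q - p - q) = real (p * q) - real p - real q"
      using pq by (simp add: of_nat_diff)
    \<comment> \<open>The conjugated weights of \<open>x * y\<close> add to \<open>p * q\<close> in
      the real part and subtract from it in the imaginary part.\<close>
    ultimately have "l = of_nat q * cnj ?\<kappa> + of_nat p * cnj ?\<kappa> + of_nat (p * q) * ?\<kappa>"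
      by (simp add: complex_eq_iff algebra_simps)
    then have "exp l = exp (of_nat q * cnj ?\<kappa>) * exp (of_nat p * cnj ?\<kappa>) * exp (of_nat (p * q) * ?\<kappa>)"
      by (metis exp_add)
    then show "?f (exp (of_nat q * ?\<kappa>) * x, exp (of_nat p * ?\<kappa>) * y) = exp l * ?f (x, y)"
      by (simp add: power_mult_distrib exp_twist_power exp_cnj algebra_simps)
  qed
  \<comment> \<open>Ensures that the exponent \<open>c = a * (p - 1) - b\<close> of \<open>w\<close>
    is not truncated. Multiplied by \<open>q\<close>, the claim becomes
    \<open>1 \<le> a * (p * q - p - q)\<close>.\<close>
  have b: "b \<le> a * (p - 1)"
  proof -
    have "a \<noteq> 0" using ab assms by (cases "a = 0") auto
    then have "p * a + 1 \<le> p * a + a * (p * q - p - q)"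
      using pq by (simp add: Suc_le_eq)
    also have "\<dots> = q * (a * (p - 1))"
    proof -
      obtain d where d: "p * q = p + q + d"
        using pq less_imp_add_positive by metis
      then have "q * (p - 1) = p + d"
        by (simp add: diff_mult_distrib2 mult.commute)
      then show ?thesis
        by (simp add: d distrib_left mult.left_commute [of q])
    qed
    finally have "q * b \<le> q * (a * (p - 1))" using ab by simp
    then show ?thesis using assms by simp
  qed
  have "\<exists>\<U> :: (complex \<times> complex) set set. finite \<U> \<and> card \<U> = p * q - p - q + 1 \<and>
    homology_group 2 (top_of_set f.susp) \<cong> free_Abelian_group \<U>"
  proof (rule f.second_homology_susp_free [OF ab])
    show "x \<noteq> 0 \<and> y \<noteq> 0" if "?f (x, y) \<noteq> 0" for x y
      using that by auto
    show "sgn (?f (s ^ q * w ^ a, s ^ p * w ^ b)) = sgn (s ^ (p * q - p - q) * w ^ (a * (p - 1) - b) * (1 + w))"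
      if "s \<noteq> 0" "w \<noteq> 0" for s w
    proof -
      have unit: "cnj (sgn z) = inverse (sgn z)" "sgn z \<noteq> 0" if "z \<noteq> 0" for z :: complex
        using that by (auto simp: cnj_sgn_eq_inverse sgn_zero_iff)
      have sgn_cnj: "sgn (cnj z) = cnj (sgn z)" for z :: complex
        by (simp add: sgn_eq)
      let ?s = "sgn s" and ?w = "sgn w"
      have "p * q = p * q - p - q + q + p"
        using pq by linarith
      then have "?s ^ (p * q) = ?s ^ (p * q - p - q) * ?s ^ q * ?s ^ p"
        by (metis power_add)
      moreover have "a * p = (a * (p - 1) - b) + a + b"
      proof -
        have "a * p = a * (p - 1) + a"
          using assms(1) by (cases p) auto
        then show ?thesis
          using b by linarith
      qed
      then have "?w ^ (a * p) = ?w ^ (a * (p - 1) - b) * ?w ^ a * ?w ^ b"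
        by (simp flip: power_add)
      \<comment> \<open>On directions conjugation is inversion, so the conjugated monomial lowers
        the exponents of \<open>s\<close> and \<open>w\<close> instead of raising them.\<close>
      ultimately have "sgn (?f (s ^ q * w ^ a, s ^ p * w ^ b)) =
          (cnj ?s ^ q * ?s ^ q) * (cnj ?s ^ p * ?s ^ p) * (cnj ?w ^ a * ?w ^ a) * (cnj ?w ^ b * ?w ^ b) *
          (?s ^ (p * q - p - q) * ?w ^ (a * (p - 1) - b) * sgn (1 + w))"
        unfolding fst_conv snd_conv tor
        by (simp only: sgn_mult sgn_power_complex sgn_cnj complex_cnj_mult complex_cnj_power ac_simps)
      also have "\<dots> = ?s ^ (p * q - p - q) * ?w ^ (a * (p - 1) - b) * sgn (1 + w)"
        using unit [OF that(1)] unit [OF that(2)] by (simp flip: power_mult_distrib)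
      finally show ?thesis
        by (simp only: sgn_mult sgn_power_complex)
    qed
  qed
  moreover have "f.H = F p q"
    by (simp only: f.H_def F_def case_prod_unfold fst_conv snd_conv fun_eq_iff) simp
  then have "homology_group 2 (top_of_set (page (F p q) \<epsilon> \<theta>)) \<cong> homology_group 2 (top_of_set f.susp)"
    using f.page_homeomorphic_susp [OF assms(4,5)]
    by (simp add: homeomorphic_space_imp_isomorphic_homology_groups)
  ultimately show "\<exists>\<U> :: (complex \<times> complex) set set. finite \<U> \<and> card \<U> = p * q - p - q + 1 \<and>
      homology_group 2 (top_of_set (page (F p q) \<epsilon> \<theta>)) \<cong> free_Abelian_group \<U>"
    by (meson iso_trans)
qed

theorem theorem4p7:
  fixes p q :: nat
  assumes "p \<ge> 2" and "q \<ge> 2" and "gcd p q = 1"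
  shows "\<exists>\<epsilon>\<^sub>0>0. \<forall>\<epsilon>. 0 < \<epsilon> \<and> \<epsilon> < \<epsilon>\<^sub>0 \<longrightarrow>
    link (F p q) \<epsilon> homeomorphic link (G p q) \<epsilon> \<and>
    \<not> open_book_equiv (sphere 0 \<epsilon>) (milnor_open_book (F p q) \<epsilon>) (milnor_open_book (G p q) \<epsilon>)"
\<comment> \<open>The bound 1 is arbitrary: the argument works at every positive radius.\<close>
proof (intro exI [of _ 1] conjI allI impI notI link_homeomorphic)
  fix \<epsilon> :: real
  assume \<epsilon>: "0 < \<epsilon> \<and> \<epsilon> < 1"
    and "open_book_equiv (sphere 0 \<epsilon>) (milnor_open_book (F p q) \<epsilon>) (milnor_open_book (G p q) \<epsilon>)"
  then obtain h k where hk: "homeomorphism (sphere 0 \<epsilon>) (sphere 0 \<epsilon>) h k"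
    and pages: "(\<lambda>P. h ` P) ` page (F p q) \<epsilon> ` sphere 0 1 = page (G p q) \<epsilon> ` sphere 0 1"
    unfolding open_book_equiv_def milnor_open_book_def by auto
  \<comment> \<open>One page suffices, but its image may be any page of \<open>G\<close>, so the
    count for \<open>G\<close> is needed at every \<open>\<theta>\<close>.\<close>
  have "1 \<in> sphere (0::complex) 1" by simp
  then have "h ` page (F p q) \<epsilon> 1 \<in> page (G p q) \<epsilon> ` sphere 0 1"
    unfolding pages [symmetric] by (intro imageI)
  then obtain \<theta> where \<theta>: "\<theta> \<in> sphere 0 1" "h ` page (F p q) \<epsilon> 1 = page (G p q) \<epsilon> \<theta>"
    by blast
  have sub: "page (F p q) \<epsilon> 1 \<subseteq> sphere 0 \<epsilon>" "page (G p q) \<epsilon> \<theta> \<subseteq> sphere 0 \<epsilon>"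
    by (auto simp: page_def)
  have "page (F p q) \<epsilon> 1 homeomorphic page (G p q) \<epsilon> \<theta>"
    unfolding homeomorphic_def using homeomorphism_of_subsets [OF hk sub \<theta>(2)] by blast
  then have iso: "homology_group 2 (top_of_set (page (F p q) \<epsilon> 1)) \<cong> homology_group 2 (top_of_set (page (G p q) \<epsilon> \<theta>))"
    by (simp add: homeomorphic_space_imp_isomorphic_homology_groups)
  obtain \<U> :: "(complex \<times> complex) set set" where \<U>: "finite \<U>" "card \<U> = p * q - p - q + 1"
    "homology_group 2 (top_of_set (page (F p q) \<epsilon> 1)) \<cong> free_Abelian_group \<U>"
    using page_second_homology(2) [OF assms, of \<epsilon> 1] \<epsilon> by auto
  obtain \<V> :: "(complex \<times> complex) set set" where \<V>: "finite \<V>" "card \<V> = p * q + p + q + 1"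
    "homology_group 2 (top_of_set (page (G p q) \<epsilon> \<theta>)) \<cong> free_Abelian_group \<V>"
    using page_second_homology(1) [OF assms, of \<epsilon> \<theta>] \<epsilon> \<theta>(1) by auto
  have "free_Abelian_group \<U> \<cong> homology_group 2 (top_of_set (page (F p q) \<epsilon> 1))"
    using \<U>(3) by (simp add: group.iso_sym)
  from iso_trans [OF iso_trans [OF this iso] \<V>(3)] have "\<U> \<approx> \<V>"
    by (simp add: isomorphic_free_Abelian_groups)
  then have "card \<U> = card \<V>"
    using \<U>(1) \<V>(1) eqpoll_iff_card by blast
  then show False
    using \<U>(2) \<V>(2) assms(1) by linarith
qed simp

end
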